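(* Simple factor dressing preserves the Hopf differential: let $\Phi$ be a non-flat LWR frame, $g$ a $z$-independent simple factor, and $g\#\Phi$ the simple factor dressing of $\Phi$ by $g$. For any $\lambda_0\neq\lambda_1$, the immersions induced by $\Phi$ and by $g\#\Phi$ at the evaluation points $(\lambda_0,\lambda_1)$, in $\mathbb E^3$ as well as in $\mathbb H^3$, have the same Hopf differential (where both are defined).
   Context: Ambient spaces. $\mathcal H_2$: $2\times2$ Hermitian matrices with $\langle x,y\rangle=-\frac12\operatorname{tr}(x\widehat y)$ ($\widehat y$ the adjugate). $\mathbb H^3=\{x\in\mathcal H_2:\det x=1,\operatorname{tr}x>0\}$; $\mathbb E^3=T_{\mathrm I}\mathbb H^3$ = trace-free Hermitian matrices, oriented so that $(x,y,-\frac i2[x,y])$ is positive; the orientation is transported to $\mathbb H^3$ by $x\mapsto VxV^*$, $V\in \mathrm{SL}_2\mathbb C$. For a conformal immersion $f$ (coordinate $z=x+iy$): unit normal $N$ with $(f_x,f_y,N)$ positively oriented orthogonal; Hopf differential $Q\,dz^2$ and mean curvature $H$ defined by $-\langle df,dN\rangle=Q\,dz^2+H\,ds^2+\bar Q\,d\bar z^2$. LWR potential: locally $\xi_\lambda=(A\lambda+B)dz$ ($\lambda\in\mathbb C$) with $A,B$ holomorphic in $z$, $\mathrm{sl}_2\mathbb C$-valued, $A$ nilpotent. LWR frame: $\mathrm{SL}_2\mathbb C$-valued $\Phi_\lambda$, holomorphic in $z$ and in $\lambda\in\mathbb C$, with $\Phi^{-1}d\Phi$ an LWR potential. Induced immersions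 at $(\lambda_0,\lambda_1)$: $f^{\mathbb E}=\psi+\psi^*$, $\psi=(\lambda_1-\lambda_0)(\dot\Phi\Phi^{-1})_{\lambda_0}$ (dot $=\partial_\lambda$); $f^{\mathbb H}=\Psi^*\Psi$, $\Psi=\Phi_{\lambda_1}\Phi_{\lambda_0}^{-1}$ (immersions away from zeros of $A$). $\Phi$ is non-flat if the Hopf differential of the induced immersions is not identically zero. Simple factor: for $\alpha\in\mathbb C$ and $\ell\neq m\in\mathbb CP^1$, $\mathrm{SF}(\alpha,\ell,m):=S\Delta S^{-1}$ with $\Delta=\begin{pmatrix}\lambda-\alpha&0\\0&1\end{pmatrix}$ and $S\in \mathrm{GL}_2\mathbb C$ independent of $\lambda$ with first column in $\ell$ and second column in $m$. For a non-flat LWR frame $\Phi$ and a $z$-independent simple factor $g$ there is a unique $z$-dependent simple factor $h$ such that $g\#\Phi:=g\Phi h^{-1}$ is an LWR frame (off a set of isolated points); if $g=\mathrm{SF}(\alpha,\ell,m)$ then $h=\mathrm{SF}(\alpha,\Phi_\alpha^{-1}\ell,\operatorname{span}w)$, where $w=(a,b)$ is a spinor: $A=w\,(-b\ \ a)$. The map $\Phi\mapsto g\#\Phi$ is the simple factor dressing. *)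

theory Defs
  imports "HOL-Analysis.Analysis"
begin

type_synonym cmat2 = "complex^2^2"

definition cadjoint :: "cmat2 \<Rightarrow> cmat2" where
  "cadjoint M = (\<chi> i j. cnj (M $ j $ i))"

definition hermitian :: "cmat2 \<Rightarrow> bool" where
  "hermitian M \<longleftrightarrow> cadjoint M = M"

definition adjugate :: "cmat2 \<Rightarrow> cmat2" where
  "adjugate M = vector [vector [M$2$2, - M$1$2], vector [- M$2$1, M$1$1]]"

text \<open>For Hermitian arguments the trace below is real, so taking the real part only changes the type.\<close>

definition herm_inner :: "cmat2 \<Rightarrow> cmat2 \<Rightarrow> real" where
  "herm_inner x y = - Re (trace (x ** adjugate y)) / 2"


section \<open>The two space forms\<close>

datatype space_form = Euclidean | Hyperbolic

fun model_space :: "space_form \<Rightarrow> cmat2 set" where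
  "model_space Euclidean = {x. hermitian x \<and> trace x = 0}"
| "model_space Hyperbolic = {x. hermitian x \<and> det x = 1 \<and> Re (trace x) > 0}"

text \<open>The hyperbolic space is the quadric \<open>herm_inner p p = -1\<close>, so its tangent space at \<open>p\<close> is the
  orthogonal complement of \<open>p\<close>.\<close>

fun tangent :: "space_form \<Rightarrow> cmat2 \<Rightarrow> cmat2 set" where
  "tangent Euclidean p = {x. hermitian x \<and> trace x = 0}"
| "tangent Hyperbolic p = {x. hermitian x \<and> herm_inner x p = 0}"

definition cross :: "cmat2 \<Rightarrow> cmat2 \<Rightarrow> cmat2" where
  "cross x y = mat (- \<i> / 2) ** (x ** y - y ** x)"

text \<open>In Euclidean space \<open>cross x y\<close> is orthogonal to \<open>x\<close> and \<open>y\<close>, and \<open>(x, y, cross x y)\<close> is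
  positive for independent \<open>x\<close> and \<open>y\<close>; hence \<open>(x, y, n)\<close> is positive iff \<open>n\<close> has a positive component
  along \<open>cross x y\<close>. The tangent space of the hyperbolic space at \<open>V V\<^sup>*\<close> is oriented by transport from the
  one at the identity.\<close>

fun positively_oriented :: "space_form \<Rightarrow> cmat2 \<Rightarrow> cmat2 \<Rightarrow> cmat2 \<Rightarrow> cmat2 \<Rightarrow> bool" where
  "positively_oriented Euclidean p x y n \<longleftrightarrow> herm_inner (cross x y) n > 0"
| "positively_oriented Hyperbolic p x y n \<longleftrightarrow>
     (\<exists>V x' y' n'. det V = 1 \<and> p = V ** cadjoint V \<and>
        x = V ** x' ** cadjoint V \<and> y = V ** y' ** cadjoint V \<and> n = V ** n' ** cadjoint V \<and>
        herm_inner (cross x' y') n' > 0)"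


section \<open>Conformal immersions and their Hopf differentials\<close>

abbreviation differential :: "(complex \<Rightarrow> cmat2) \<Rightarrow> complex \<Rightarrow> complex \<Rightarrow> cmat2" where
  "differential f z \<equiv> frechet_derivative f (at z)"

definition conformal_immersion_on :: "space_form \<Rightarrow> complex set \<Rightarrow> (complex \<Rightarrow> cmat2) \<Rightarrow> bool" where
  "conformal_immersion_on S W f \<longleftrightarrow>
     (\<forall>z\<in>W. f z \<in> model_space S \<and> f differentiable (at z) \<and>
        (let fx = differential f z 1; fy = differential f z \<i>
         in herm_inner fx fx = herm_inner fy fy \<and> herm_inner fx fx > 0 \<and> herm_inner fx fy = 0))"

definition unit_normal :: "space_form \<Rightarrow> (complex \<Rightarrow> cmat2) \<Rightarrow> complex \<Rightarrow> cmat2 \<Rightarrow> bool" where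
  "unit_normal S f z n \<longleftrightarrow>
     (let fx = differential f z 1; fy = differential f z \<i>
      in n \<in> tangent S (f z) \<and> herm_inner n n = 1 \<and>
         herm_inner n fx = 0 \<and> herm_inner n fy = 0 \<and> positively_oriented S (f z) fx fy n)"

text \<open>\<open>has_hopf_differential S f z Q\<close>: near \<open>z\<close> the map \<open>f\<close> is a conformal immersion, and its Hopf
  differential at \<open>z\<close> is \<open>Q dz\<^sup>2\<close>. The defining identity
  \<open>- \<langle>df, dN\<rangle> = Q dz\<^sup>2 + H ds\<^sup>2 + cnj Q d(cnj z)\<^sup>2\<close> is one of quadratic forms, evaluated here on
  tangent vectors \<open>v\<close>; the mean curvature \<open>H\<close> is determined along with \<open>Q\<close>.\<close>

definition has_hopf_differential ::
    "space_form \<Rightarrow> (complex \<Rightarrow> cmat2) \<Rightarrow> complex \<Rightarrow> complex \<Rightarrow> bool" where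
  "has_hopf_differential S f z Q \<longleftrightarrow>
     (\<exists>W N. open W \<and> z \<in> W \<and> conformal_immersion_on S W f \<and>
        (\<forall>u\<in>W. unit_normal S f u (N u)) \<and> N differentiable (at z) \<and>
        (\<exists>H::real. \<forall>v::complex.
           complex_of_real (- herm_inner (differential f z v) (differential N z v)) =
           Q * v\<^sup>2 + complex_of_real (H * herm_inner (differential f z v) (differential f z v)) +
           cnj Q * (cnj v)\<^sup>2))"


section \<open>Uniqueness of the Hopf differential\<close>

lemma cadjoint_mult: "cadjoint (X ** Y) = cadjoint Y ** cadjoint X"
  by (simp add: cadjoint_def matrix_matrix_mult_def vec_eq_iff sum_2 forall_2 mult.commute)

lemma adjugate_mult: "adjugate (X ** Y) = adjugate Y ** adjugate X"
  by (simp add: adjugate_def matrix_matrix_mult_def vec_eq_iff sum_2 forall_2 vector_2 algebra_simps)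

lemma adjugate_right: "X ** adjugate X = mat (det X)"
  by (simp add: adjugate_def matrix_matrix_mult_def vec_eq_iff sum_2 forall_2 vector_2 mat_def det_2 algebra_simps)

lemma det_cadjoint: "det (cadjoint V) = cnj (det V)"
  by (simp add: cadjoint_def det_2 mult.commute)

lemma herm_inner_transport:
  assumes "det V = 1"
  shows "herm_inner (V ** x ** cadjoint V) (V ** y ** cadjoint V) = herm_inner x y"
proof -
  have 1: "adjugate (V ** y ** cadjoint V) = adjugate (cadjoint V) ** adjugate y ** adjugate V"
    by (simp add: adjugate_mult matrix_mul_assoc)
  have 2: "cadjoint V ** adjugate (cadjoint V) = mat 1"
    by (simp add: adjugate_right det_cadjoint assms)
  have 3: "adjugate V ** V = mat 1"
    using adjugate_right[of V] assms matrix_left_right_inverse by auto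
  have "V ** x ** cadjoint V ** adjugate (V ** y ** cadjoint V) =
     V ** (x ** (cadjoint V ** adjugate (cadjoint V)) ** adjugate y ** adjugate V)"
    unfolding 1 by (simp only: matrix_mul_assoc)
  also have "trace \<dots> = trace ((x ** adjugate y) ** (adjugate V ** V))"
    unfolding 2 by (subst trace_mul_sym) (simp add: matrix_mul_assoc)
  finally show ?thesis by (simp add: herm_inner_def 3)
qed

lemma euclid_coords:
  assumes "hermitian x" "trace x = 0"
  obtains a b c :: real where "x = vector [vector [of_real a, Complex b c], vector [Complex b (-c), - of_real a]]"
proof -
  have "cnj (x$1$1) = x$1$1" "cnj (x$2$1) = x$1$2" "x$1$1 + x$2$2 = 0"
    using assms by (auto simp: hermitian_def cadjoint_def vec_eq_iff trace_def sum_2 forall_2)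
  then have "x = vector [vector [of_real (Re (x$1$1)), Complex (Re (x$1$2)) (Im (x$1$2))],
     vector [Complex (Re (x$1$2)) (- Im (x$1$2)), - of_real (Re (x$1$1))]]"
    by (simp add: vec_eq_iff forall_2 vector_2 complex_eq_iff)
  then show thesis by (rule that)
qed

lemma normal_coords:
  fixes a b c :: real
  assumes "n1*n1+n2*n2+n3*n3 = 1" "n1*x1+n2*x2+n3*x3 = 0" "n1*y1+n2*y2+n3*y3 = 0"
     "a = x2*y3-x3*y2" "b = x3*y1-x1*y3" "c = x1*y2-x2*y1"
  defines "D \<equiv> n1*a+n2*b+n3*c"
  shows "a = D*n1" "b = D*n2" "c = D*n3" "D^2 = a*a+b*b+c*c"
proof -
  show 1: "a = D*n1" "b = D*n2" "c = D*n3"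
    using assms(1-3) unfolding D_def assms(4-6) by algebra+
  have "D^2 = D^2*(n1*n1+n2*n2+n3*n3)" using assms(1) by simp
  also have "\<dots> = a*a+b*b+c*c" unfolding 1 by (simp add: power2_eq_square algebra_simps)
  finally show "D^2 = a*a+b*b+c*c" .
qed

lemma euclid_unique:
  assumes E: "hermitian x" "trace x = 0" "hermitian y" "trace y = 0" "hermitian n" "trace n = 0" "hermitian m" "trace m = 0"
    and "herm_inner n n = 1" "herm_inner n x = 0" "herm_inner n y = 0" "herm_inner (cross x y) n > 0"
    and "herm_inner m m = 1" "herm_inner m x = 0" "herm_inner m y = 0" "herm_inner (cross x y) m > 0"
  shows "n = m"
proof -
  obtain x1 x2 x3 where x: "x = vector [vector [of_real x1, Complex x2 x3], vector [Complex x2 (-x3), - of_real x1]]"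
    using euclid_coords E by metis
  obtain y1 y2 y3 where y: "y = vector [vector [of_real y1, Complex y2 y3], vector [Complex y2 (-y3), - of_real y1]]"
    using euclid_coords E by metis
  obtain n1 n2 n3 where n: "n = vector [vector [of_real n1, Complex n2 n3], vector [Complex n2 (-n3), - of_real n1]]"
    using euclid_coords E by metis
  obtain m1 m2 m3 where m: "m = vector [vector [of_real m1, Complex m2 m3], vector [Complex m2 (-m3), - of_real m1]]"
    using euclid_coords E by metis
  note d = herm_inner_def adjugate_def cross_def trace_def sum_2 matrix_matrix_mult_def vector_2 mat_def
    field_simps
  define a b c where "a = -(x2*y3-x3*y2)" "b = -(x3*y1-x1*y3)" "c = -(x1*y2-x2*y1)"
  note abc = this
  have N: "n1*n1+n2*n2+n3*n3 = 1" "n1*x1+n2*x2+n3*x3 = 0" "n1*y1+n2*y2+n3*y3 = 0" "n1*a+n2*b+n3*c > 0"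
    using assms(9-12) unfolding n x y abc by (simp_all add: d)
  have M: "m1*m1+m2*m2+m3*m3 = 1" "m1*x1+m2*x2+m3*x3 = 0" "m1*y1+m2*y2+m3*y3 = 0" "m1*a+m2*b+m3*c > 0"
    using assms(13-16) unfolding m x y abc by (simp_all add: d)
  have e: "-a = x2*y3-x3*y2" "-b = x3*y1-x1*y3" "-c = x1*y2-x2*y1" by (simp_all add: abc)
  let ?D = "n1*a+n2*b+n3*c" let ?E = "m1*a+m2*b+m3*c"
  note r = normal_coords[OF N(1-3) e] and s = normal_coords[OF M(1-3) e]
  have "?D^2 = ?E^2" using r(4) s(4) by (simp add: power2_eq_square algebra_simps)
  then have "?D = ?E" using N(4) M(4) by (simp add: power2_eq_iff)
  then have D: "n1*-a+n2*-b+n3*-c = m1*-a+m2*-b+m3*-c" "n1*-a+n2*-b+n3*-c \<noteq> 0" using N(4) by simp_all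
  have "n1 = m1" "n2 = m2" "n3 = m3"
    using r(1-3) s(1-3) D by (metis mult_left_cancel)+
  then show ?thesis by (simp add: n m)
qed

lemma transport_inj:
  assumes "det V = 1" "V ** x ** cadjoint V = V ** y ** cadjoint V" shows "x = y"
proof -
  have 3: "adjugate V ** V = mat 1"
    using adjugate_right[of V] assms(1) matrix_left_right_inverse by auto
  have 4: "cadjoint V ** adjugate (cadjoint V) = mat 1"
    by (simp add: adjugate_right det_cadjoint assms(1))
  have "x = (adjugate V ** V) ** x ** (cadjoint V ** adjugate (cadjoint V))" by (simp add: 3 4)
  also have "\<dots> = adjugate V ** (V ** x ** cadjoint V) ** adjugate (cadjoint V)"
    by (simp only: matrix_mul_assoc)
  also have "\<dots> = adjugate V ** (V ** y ** cadjoint V) ** adjugate (cadjoint V)"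
    by (simp add: assms(2))
  also have "\<dots> = (adjugate V ** V) ** y ** (cadjoint V ** adjugate (cadjoint V))"
    by (simp only: matrix_mul_assoc)
  finally show ?thesis by (simp add: 3 4)
qed

lemma cadjoint_cadjoint: "cadjoint (cadjoint X) = X" by (simp add: cadjoint_def vec_eq_iff)

lemma transport_herm:
  assumes "det V = 1" shows "hermitian (V ** x ** cadjoint V) \<longleftrightarrow> hermitian x"
proof -
  have "cadjoint (V ** x ** cadjoint V) = V ** cadjoint x ** cadjoint V"
    by (simp add: cadjoint_mult cadjoint_cadjoint matrix_mul_assoc)
  then show ?thesis unfolding hermitian_def using transport_inj[OF assms] by metis
qed

lemma trace_herm: "hermitian x \<Longrightarrow> Im (trace x) = 0"
proof -
  assume "hermitian x"
  then have "cnj (x$1$1) = x$1$1" "cnj (x$2$2) = x$2$2"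
    by (auto simp: hermitian_def cadjoint_def vec_eq_iff)
  then show ?thesis by (auto simp: trace_def sum_2 complex_eq_iff)
qed

lemma transport_tangent:
  assumes "det V = 1" "V ** x ** cadjoint V \<in> tangent Hyperbolic (V ** cadjoint V)"
  shows "hermitian x" "trace x = 0"
proof -
  show h: "hermitian x" using assms transport_herm by simp
  have "herm_inner (V ** x ** cadjoint V) (V ** mat 1 ** cadjoint V) = 0" using assms by simp
  then have "herm_inner x (mat 1) = 0" by (simp only: herm_inner_transport[OF assms(1)])
  moreover have "adjugate (mat 1) = mat 1" by (simp add: adjugate_def vec_eq_iff forall_2 vector_2 mat_def)
  ultimately show "trace x = 0" using trace_herm[OF h] by (simp add: herm_inner_def complex_eq_iff)
qed

lemma cross_transport:
  assumes "U ** cadjoint U = mat 1" "det U = 1"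
  shows "cross (U ** x ** cadjoint U) (U ** y ** cadjoint U) = U ** cross x y ** cadjoint U"
proof -
  have 1: "cadjoint U ** U = mat 1" using assms(1) matrix_left_right_inverse by auto
  have 2: "(U ** x ** cadjoint U) ** (U ** y ** cadjoint U) = U ** (x ** y) ** cadjoint U" for x y
  proof -
    have "(U ** x ** cadjoint U) ** (U ** y ** cadjoint U) = U ** x ** (cadjoint U ** U) ** y ** cadjoint U"
      by (simp only: matrix_mul_assoc)
    then show ?thesis by (simp add: 1 matrix_mul_assoc)
  qed
  have 3: "mat c ** (U ** X ** cadjoint U) = U ** (mat c ** X) ** cadjoint U" for c X
    by (simp add: matrix_matrix_mult_def vec_eq_iff sum_2 forall_2 mat_def algebra_simps)
  show ?thesis unfolding cross_def 2 by (simp only: 3[symmetric])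
    (simp add: matrix_matrix_mult_def vec_eq_iff sum_2 forall_2 mat_def algebra_simps)
qed

lemma unit_normal_unique:
  assumes n: "unit_normal S f z n" and m: "unit_normal S f z m"
    and T: "differential f z 1 \<in> tangent S (f z)" "differential f z \<i> \<in> tangent S (f z)"
  shows "n = m"
proof (cases S)
  case Euclidean
  show ?thesis
    by (rule euclid_unique[of "differential f z 1" "differential f z \<i>"])
      (use n m T in \<open>auto simp: Euclidean unit_normal_def Let_def\<close>)
next
  case Hyperbolic
  let ?x = "differential f z 1" and ?y = "differential f z \<i>" and ?p = "f z"
  obtain V x' y' n' where V: "det V = 1" "?p = V ** cadjoint V" "?x = V ** x' ** cadjoint V"
     "?y = V ** y' ** cadjoint V" "n = V ** n' ** cadjoint V" "herm_inner (cross x' y') n' > 0"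
    using n unfolding Hyperbolic unit_normal_def Let_def positively_oriented.simps by blast
  obtain W x2 y2 m2 where W: "det W = 1" "?p = W ** cadjoint W" "?x = W ** x2 ** cadjoint W"
     "?y = W ** y2 ** cadjoint W" "m = W ** m2 ** cadjoint W" "herm_inner (cross x2 y2) m2 > 0"
    using m unfolding Hyperbolic unit_normal_def Let_def positively_oriented.simps by blast
  define U where "U = adjugate V ** W"
  have 3: "adjugate V ** V = mat 1" "V ** adjugate V = mat 1"
    using adjugate_right[of V] V(1) matrix_left_right_inverse by auto
  have WU: "W = V ** U" by (simp add: U_def matrix_mul_assoc 3)
  have dU: "det U = 1" using V(1) W(1) by (simp add: WU det_mul)
  have uU: "U ** cadjoint U = mat 1"
  proof -
    have "V ** mat 1 ** cadjoint V = V ** (U ** cadjoint U) ** cadjoint V"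
      using V(2) W(2) by (simp add: WU cadjoint_mult matrix_mul_assoc)
    then show ?thesis using transport_inj[OF V(1)] by metis
  qed
  have tr: "W ** X ** cadjoint W = V ** (U ** X ** cadjoint U) ** cadjoint V" for X
    by (simp add: WU cadjoint_mult matrix_mul_assoc)
  define m' where "m' = U ** m2 ** cadjoint U"
  have x': "x' = U ** x2 ** cadjoint U" and y': "y' = U ** y2 ** cadjoint U"
    using V W transport_inj[OF V(1)] tr by metis+
  have m': "m = V ** m' ** cadjoint V" using W(5) tr m'_def by simp
  have pos: "herm_inner (cross x' y') m' > 0"
    using W(6) unfolding x' y' m'_def cross_transport[OF uU dU] herm_inner_transport[OF dU] .
  have "n' = m'"
    using T n m V(6) pos unfolding Hyperbolic unit_normal_def Let_def V(2-5) m'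
    by (intro euclid_unique[of x' y'])
       (auto simp only: herm_inner_transport[OF V(1)] dest: transport_tangent[OF V(1)] )
  then show ?thesis using V(5) m' by simp
qed


lemma bounded_linear_cadjoint: "bounded_linear cadjoint"
  unfolding cadjoint_def
  by (intro linear_conv_bounded_linear[THEN iffD1] linearI) (simp_all add: vec_eq_iff)

lemma herm_inner_bilinear: "bounded_bilinear herm_inner"
proof -
  have "bilinear herm_inner"
    unfolding bilinear_def
    by (auto intro!: linearI simp: herm_inner_def adjugate_def trace_def sum_2 matrix_matrix_mult_def vector_2 field_simps)
  then show ?thesis by (simp add: bilinear_conv_bounded_bilinear)
qed

lemma herm_inner_self: "herm_inner x x = - Re (det x)"
  by (simp add: herm_inner_def adjugate_right trace_def mat_def sum_2)

lemma herm_inner_commute: "herm_inner x y = herm_inner y x"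
  by (simp add: herm_inner_def adjugate_def trace_def sum_2 matrix_matrix_mult_def vector_2 algebra_simps)

lemma differential_tangent:
  assumes W: "open W" "z \<in> W" and f: "conformal_immersion_on S W f"
  shows "differential f z v \<in> tangent S (f z)"
proof -
  have df: "(f has_derivative differential f z) (at z)"
    using f W by (auto simp: conformal_immersion_on_def frechet_derivative_works)
  have zero: "D v = 0" if "(g has_derivative D) (at z)" "\<And>u. u \<in> W \<Longrightarrow> g u = c"
    for g :: "complex \<Rightarrow> 'b::real_normed_vector" and D c
  proof -
    have "((\<lambda>u. c) has_derivative D) (at z)"
      using that(1) W by (rule has_derivative_transform_within_open) (use that(2) in auto)
    then have "D = (\<lambda>_. 0)" using has_derivative_const has_derivative_unique by blast
    then show ?thesis by simp
  qed
  have "((\<lambda>u. cadjoint (f u) - f u) has_derivative (\<lambda>v. cadjoint (differential f z v) - differential f z v)) (at z)"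
    by (intro has_derivative_diff bounded_linear.has_derivative[OF bounded_linear_cadjoint] df)
  from zero[OF this, of 0] have h: "hermitian (differential f z v)"
    using f by (cases S) (auto simp: conformal_immersion_on_def hermitian_def)
  show ?thesis
  proof (cases S)
    case Euclidean
    have bl: "bounded_linear (trace :: cmat2 \<Rightarrow> complex)"
      by (intro linear_conv_bounded_linear[THEN iffD1] linearI) (simp_all add: trace_def sum_2 scaleR_add_right)
    from zero[OF bounded_linear.has_derivative[OF bl df], of 0] h show ?thesis
      using f by (auto simp: Euclidean conformal_immersion_on_def)
  next
    case Hyperbolic
    have "herm_inner (f u) (f u) = -1" if "u \<in> W" for u
      using f that by (simp add: Hyperbolic conformal_immersion_on_def herm_inner_self)
    from zero[OF bounded_bilinear.FDERIV[OF herm_inner_bilinear df df] this]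
    have "herm_inner (differential f z v) (f z) = 0"
      using herm_inner_commute[of "f z" "differential f z v"] by simp
    with h show ?thesis by (simp add: Hyperbolic)
  qed
qed

lemma has_hopf_differential_unique:
  assumes "has_hopf_differential S f z Q" "has_hopf_differential S f z Q'"
  shows "Q = Q'"
proof -
  obtain W N H where 1: "open W" "z \<in> W" "conformal_immersion_on S W f" "\<And>u. u\<in>W \<Longrightarrow> unit_normal S f u (N u)"
    "N differentiable (at z)" and Q: "\<And>v. complex_of_real (- herm_inner (differential f z v) (differential N z v)) =
           Q * v\<^sup>2 + complex_of_real (H * herm_inner (differential f z v) (differential f z v)) +
           cnj Q * (cnj v)\<^sup>2"
    using assms(1) unfolding has_hopf_differential_def by blast
  obtain W' N' H' where 2: "open W'" "z \<in> W'" "conformal_immersion_on S W' f" "\<And>u. u\<in>W' \<Longrightarrow> unit_normal S f u (N' u)"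
    "N' differentiable (at z)" and Q': "\<And>v. complex_of_real (- herm_inner (differential f z v) (differential N' z v)) =
           Q' * v\<^sup>2 + complex_of_real (H' * herm_inner (differential f z v) (differential f z v)) +
           cnj Q' * (cnj v)\<^sup>2"
    using assms(2) unfolding has_hopf_differential_def by blast
  have NN: "N u = N' u" if "u \<in> W \<inter> W'" for u
    using unit_normal_unique[OF 1(4) 2(4)] differential_tangent[OF 1(1) _ 1(3)] that by auto
  have "(N has_derivative differential N z) (at z)" using 1(5) frechet_derivative_works by blast
  then have "(N' has_derivative differential N z) (at z)"
    by (rule has_derivative_transform_within_open[of _ _ _ _ "W \<inter> W'"]) (use 1 2 NN in auto)
  then have D: "differential N' z = differential N z" by (metis frechet_derivative_at)
  let ?q = "\<lambda>v. herm_inner (differential f z v) (differential f z v)"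
  have c: "?q 1 = ?q \<i>" "herm_inner (differential f z 1) (differential f z \<i>) = 0"
    using 1(2,3) by (auto simp: conformal_immersion_on_def Let_def)
  have "linear (differential f z)"
    using 1(2,3) by (auto simp: conformal_immersion_on_def intro: linear_frechet_derivative)
  then have "differential f z (1+\<i>) = differential f z 1 + differential f z \<i>" by (rule linear_add)
  then have "?q (1+\<i>) = ?q 1 + herm_inner (differential f z 1) (differential f z \<i>) +
      (herm_inner (differential f z \<i>) (differential f z 1) + ?q \<i>)"
    by (simp only: bounded_bilinear.add_left[OF herm_inner_bilinear]
        bounded_bilinear.add_right[OF herm_inner_bilinear] add.assoc)
  then have c2: "?q (1+\<i>) = 2 * ?q 1"
    using c herm_inner_commute[of "differential f z 1" "differential f z \<i>"] by linarith
  have E: "Q * v\<^sup>2 + complex_of_real (H * ?q v) + cnj Q * (cnj v)\<^sup>2 = Q' * v\<^sup>2 + complex_of_real (H' * ?q v) + cnj Q' * (cnj v)\<^sup>2" for v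
    using Q[of v] Q'[of v] D by simp
  define r where "r = ?q 1"
  note e1 = E[of 1, folded r_def] and e2 = E[of \<i>, folded c(1), folded r_def]
    and e3 = E[of "1+\<i>", unfolded c2, folded r_def]
  have "2 * Re Q + H * r = 2 * Re Q' + H' * r" using arg_cong[OF e1, of Re] by simp
  moreover have "- 2 * Re Q + H * r = - 2 * Re Q' + H' * r" using arg_cong[OF e2, of Re] by simp
  moreover have "- 4 * Im Q + 2 * (H * r) = - 4 * Im Q' + 2 * (H' * r)"
    using arg_cong[OF e3, of Re] by (simp add: power2_eq_square algebra_simps)
  ultimately show ?thesis by (simp add: complex_eq_iff)
qed


section \<open>Loop Weierstrass representation\<close>

definition holomorphic_mat_on :: "(complex \<Rightarrow> cmat2) \<Rightarrow> complex set \<Rightarrow> bool" where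
  "holomorphic_mat_on F W \<longleftrightarrow> (\<forall>i j. (\<lambda>z. F z $ i $ j) holomorphic_on W)"

definition deriv_mat :: "(complex \<Rightarrow> cmat2) \<Rightarrow> complex \<Rightarrow> cmat2" where
  "deriv_mat F z = (\<chi> i j. deriv (\<lambda>u. F u $ i $ j) z)"

definition nilpotent_mat :: "cmat2 \<Rightarrow> bool" where
  "nilpotent_mat M \<longleftrightarrow> (\<exists>n. (((**) M) ^^ n) (mat 1) = 0)"

text \<open>\<open>A\<close> and \<open>B\<close> are the coefficients of the potential \<open>(A \<lambda> + B) dz\<close>.\<close>

definition lwr_potential ::
    "complex set \<Rightarrow> (complex \<Rightarrow> cmat2) \<Rightarrow> (complex \<Rightarrow> cmat2) \<Rightarrow> bool" where
  "lwr_potential U A B \<longleftrightarrow>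
     holomorphic_mat_on A U \<and> holomorphic_mat_on B U \<and>
     (\<forall>z\<in>U. trace (A z) = 0 \<and> trace (B z) = 0 \<and> nilpotent_mat (A z))"

text \<open>Frames take the point \<open>z\<close> first and the spectral parameter \<open>\<lambda>\<close> second.\<close>

type_synonym frame = "complex \<Rightarrow> complex \<Rightarrow> cmat2"

definition lwr_frame ::
    "complex set \<Rightarrow> (complex \<Rightarrow> cmat2) \<Rightarrow> (complex \<Rightarrow> cmat2) \<Rightarrow> frame \<Rightarrow> bool" where
  "lwr_frame U A B \<Phi> \<longleftrightarrow>
     lwr_potential U A B \<and>
     (\<forall>l. holomorphic_mat_on (\<lambda>z. \<Phi> z l) U) \<and>
     (\<forall>z\<in>U. holomorphic_mat_on (\<Phi> z) UNIV) \<and>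
     (\<forall>z\<in>U. \<forall>l. det (\<Phi> z l) = 1 \<and>
        matrix_inv (\<Phi> z l) ** deriv_mat (\<lambda>u. \<Phi> u l) z = mat l ** A z + B z)"

fun induced :: "space_form \<Rightarrow> frame \<Rightarrow> complex \<Rightarrow> complex \<Rightarrow> complex \<Rightarrow> cmat2" where
  "induced Euclidean \<Phi> l0 l1 z =
     (let \<psi> = mat (l1 - l0) ** (deriv_mat (\<Phi> z) l0 ** matrix_inv (\<Phi> z l0)) in \<psi> + cadjoint \<psi>)"
| "induced Hyperbolic \<Phi> l0 l1 z =
     (let \<Psi> = \<Phi> z l1 ** matrix_inv (\<Phi> z l0) in cadjoint \<Psi> ** \<Psi>)"

text \<open>The Hopf differential of \<open>induced S \<Phi> l0 l1\<close> does not depend on \<open>S\<close>, and on \<open>(l0, l1)\<close> only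
  through the factor \<open>l1 - l0\<close>, so the quantifiers over \<open>S\<close>, \<open>l0\<close>, \<open>l1\<close> could equally be universal.\<close>

definition non_flat :: "complex set \<Rightarrow> frame \<Rightarrow> bool" where
  "non_flat U \<Phi> \<longleftrightarrow>
     (\<exists>S l0 l1 z Q. l0 \<noteq> l1 \<and> z \<in> U \<and> has_hopf_differential S (induced S \<Phi> l0 l1) z Q \<and> Q \<noteq> 0)"


section \<open>Simple factor dressing\<close>

definition CP1 :: "(complex^2) set set" where
  "CP1 = {vec.span {v} | v. v \<noteq> 0}"

definition is_SF ::
    "complex \<Rightarrow> (complex^2) set \<Rightarrow> (complex^2) set \<Rightarrow> (complex \<Rightarrow> cmat2) \<Rightarrow> bool" where
  "is_SF \<alpha> L M g \<longleftrightarrow>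
     (\<exists>S::cmat2. invertible S \<and> column 1 S \<in> L \<and> column 2 S \<in> M \<and>
        (\<forall>l. g l = S ** vector [vector [l - \<alpha>, 0], vector [0, 1]] ** matrix_inv S))"

definition simple_factor :: "(complex \<Rightarrow> cmat2) \<Rightarrow> bool" where
  "simple_factor g \<longleftrightarrow> (\<exists>\<alpha>. \<exists>L\<in>CP1. \<exists>M\<in>CP1. L \<noteq> M \<and> is_SF \<alpha> L M g)"

text \<open>\<open>\<Phi>'\<close> is the dressed frame \<open>g # \<Phi>\<close>, defined off the set \<open>P\<close> of isolated points. A simple factor \<open>h z\<close> is
  singular at exactly one \<open>l\<close>, where the value of \<open>\<Phi>' z\<close> is the holomorphic extension.\<close>

definition is_dressing :: "complex set \<Rightarrow> (complex \<Rightarrow> cmat2) \<Rightarrow> frame \<Rightarrow> complex set \<Rightarrow> frame \<Rightarrow> bool" where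
  "is_dressing U g \<Phi> P \<Phi>' \<longleftrightarrow>
     P sparse_in U \<and> (\<exists>A B. lwr_frame (U - P) A B \<Phi>') \<and>
     (\<exists>h. \<forall>z\<in>U - P. simple_factor (h z) \<and>
        (\<forall>l. invertible (h z l) \<longrightarrow> \<Phi>' z l = g l ** \<Phi> z l ** matrix_inv (h z l)))"

end

theory Submission
  imports Defs
begin

text \<open>Both Hopf differentials equal \<open>(l1 - l0) tr (A A') dz\<^sup>2\<close>, where \<open>A\<close> and \<open>A'\<close> are the nilpotent
  coefficients of the two potentials. This expression is symmetric in the two frames and refers to
  neither the space form nor the individual evaluation points. It comes from two computations.

  First, the Hopf differential of a single frame is read off from its potential. Up to transport
  of tangent vectors to the base point, the \<open>dz\<close>-part of the differential of either immersion is
  \<open>Y = (l1 - l0) \<Phi> A \<Phi>\<^sup>-\<^sup>1\<close>, taken at \<open>l0\<close> for the Euclidean and at \<open>l1\<close> for the hyperbolic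
  immersion. As \<open>Y\<close> is nilpotent it spans an isotropic line, which makes the immersion conformal and
  determines the unit normal \<open>1 - 2 Y Y\<^sup>* / tr (Y Y\<^sup>*)\<close>. Differentiating that normal gives the Hopf
  differential \<open>Q\<close> as the factor in \<open>Y (dY/dz) = Q Y\<close>, and this is \<open>Q = (l1 - l0) q\<close> with \<open>q\<close>
  defined by \<open>A (dA/dz) + A B A = q A\<close>: the terms with \<open>l\<close> drop out because \<open>A A = 0\<close>. This is
  \<open>has_hopf_differential_induced\<close>. Working with \<open>A\<close> itself avoids choosing a spinor \<open>w\<close> with
  \<open>A = w (-b a)\<close>, that is, a square root.

  Second, a simple factor is \<open>h = 1 + (l - \<alpha> - 1) \<pi>\<close> with a projection \<open>\<pi>\<close> of rank one, and
  \<open>\<Phi>' h = g \<Phi>\<close> forces \<open>h\<close> to have the same singular point \<open>\<alpha>\<close> as \<open>g\<close>, by comparing determinants.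
  Differentiating this identity in \<open>z\<close> gives polynomial relations in \<open>l\<close>; their
  coefficients say that the two potentials agree at \<open>l = \<alpha> + 1\<close>, where \<open>h = 1\<close>, that
  \<open>A' \<pi> = \<pi> A\<close>, and what the derivative of \<open>\<pi>\<close> is. Nilpotency turns the second relation into
  \<open>\<pi> A = 0 = A' \<pi>\<close> (\<open>intertwined_nilpotents\<close>); so \<open>1 - \<pi>\<close> fixes \<open>A\<close> and \<open>\<pi>\<close> fixes \<open>A'\<close>, and
  differentiating these gives \<open>A (dA/dz) + A B A = A A' A\<close> together with the mirror image of this equation.
  Since a matrix \<open>R\<close> of rank one satisfies \<open>R M R = tr (R M) R\<close>, the two factors \<open>q\<close> are
  \<open>tr (A A')\<close> and \<open>tr (A' A)\<close>.\<close>

section \<open>Algebra of two-by-two matrices\<close>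

text \<open>Scalar multiplication by complex numbers. Written as \<open>mat c ** X\<close> it could not be moved past
  other factors by rewriting, since the rule for that would loop.\<close>

definition cscale :: "complex \<Rightarrow> cmat2 \<Rightarrow> cmat2"  (infixr "*\<^sub>M" 75) where
  "c *\<^sub>M X = (\<chi> i j. c * X $ i $ j)"

lemmas entrywise = vec_eq_iff forall_2 matrix_matrix_mult_def sum_2 trace_def det_2 cscale_def
  mat_def adjugate_def vector_2 cadjoint_def

lemma mat_mult_eq_cscale: "mat c ** X = c *\<^sub>M X"
  by (simp add: entrywise)

lemma cscale_cscale [simp]: "a *\<^sub>M b *\<^sub>M X = (a * b) *\<^sub>M X"
  and cscale_one [simp]: "1 *\<^sub>M X = X"
  and cscale_zero_left [simp]: "0 *\<^sub>M X = 0"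
  and cscale_zero_right [simp]: "c *\<^sub>M 0 = (0 :: cmat2)"
  and mult_cscale_left [simp]: "(c *\<^sub>M X) ** Y = c *\<^sub>M (X ** Y)"
  and mult_cscale_right [simp]: "X ** c *\<^sub>M Y = c *\<^sub>M (X ** Y)"
  by (simp_all add: entrywise algebra_simps)

lemma cscale_add_right: "c *\<^sub>M (X + Y) = c *\<^sub>M X + c *\<^sub>M Y"
  and cscale_diff_right: "c *\<^sub>M (X - Y) = c *\<^sub>M X - c *\<^sub>M Y"
  and cscale_minus_right: "c *\<^sub>M (- X) = - (c *\<^sub>M X)"
  and cscale_add_left: "(a + b) *\<^sub>M X = a *\<^sub>M X + b *\<^sub>M X"
  and cscale_diff_left: "(a - b) *\<^sub>M X = a *\<^sub>M X - b *\<^sub>M X"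
  and cscale_minus_left: "(- a) *\<^sub>M X = - (a *\<^sub>M X)"
  and mult_diff_right: "X ** (Y - Z) = X ** Y - X ** Z" for X Y Z :: cmat2
  by (simp_all add: entrywise algebra_simps)

lemma mult_diff_left: "(X - Y) ** Z = X ** Z - Y ** Z"
  and mult_add_left: "(X + Y) ** Z = X ** Z + Y ** Z"
  and mult_minus_left: "(- X) ** Z = - (X ** Z)"
  and mult_minus_right: "X ** (- Z) = - (X ** Z)"
  and mult_zero_left_mat: "0 ** X = 0"
  and mult_zero_right_mat: "X ** 0 = 0" for X Y Z :: cmat2
  by (simp_all add: entrywise algebra_simps)

lemmas expand_mat = matrix_mul_assoc matrix_add_ldistrib mult_add_left mult_diff_left
  mult_diff_right mult_minus_left mult_minus_right mult_zero_left_mat mult_zero_right_mat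
  cscale_add_right cscale_diff_right cscale_minus_right

lemma cscale_eq_0_iff: "c *\<^sub>M X = 0 \<longleftrightarrow> c = 0 \<or> X = 0"
  by (auto simp: entrywise)

lemma cscale_cancel: "c \<noteq> 0 \<Longrightarrow> c *\<^sub>M X = c *\<^sub>M Y \<longleftrightarrow> X = Y"
  by (auto simp: entrywise)

lemma trace_cscale [simp]: "trace (c *\<^sub>M X) = c * trace X"
  and trace_minus: "trace (- X) = - trace X"
  and trace_add': "trace (X + Y) = trace X + trace Y"
  and trace_diff: "trace (X - Y) = trace X - trace Y"
  and trace_mat1: "trace (mat 1 :: cmat2) = 2"
  and det_cscale: "det (c *\<^sub>M X) = c\<^sup>2 * det X"
  and cadjoint_cscale [simp]: "cadjoint (c *\<^sub>M X) = cnj c *\<^sub>M cadjoint X"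
  and cadjoint_add: "cadjoint (X + Y) = cadjoint X + cadjoint Y"
  and cadjoint_diff: "cadjoint (X - Y) = cadjoint X - cadjoint Y"
  and cadjoint_mat1: "cadjoint (mat 1) = mat 1"
  and trace_cadjoint: "trace (cadjoint X) = cnj (trace X)"
  and adjugate_cscale: "adjugate (c *\<^sub>M X) = c *\<^sub>M adjugate X"
  and adjugate_trace: "adjugate X = trace X *\<^sub>M mat 1 - X"
  for X Y :: cmat2
  by (simp_all add: entrywise algebra_simps power2_eq_square)

lemma cadjoint_eq_0_iff: "cadjoint X = 0 \<longleftrightarrow> X = 0"
  by (auto simp: entrywise)

text \<open>The theorem of Cayley and Hamilton for a trace-free matrix.\<close>

lemma square_trace_free:
  fixes X :: cmat2
  assumes "trace X = 0" shows "X ** X = - (det X *\<^sub>M mat 1)"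
proof -
  have "X ** adjugate X = det X *\<^sub>M mat 1" by (simp add: adjugate_right entrywise)
  then have "- (X ** X) = det X *\<^sub>M mat 1" using assms by (simp add: adjugate_trace mult_minus_right)
  then show ?thesis by (metis minus_minus)
qed

text \<open>A matrix of rank one is \<open>u v\<^sup>T\<close>, so the middle of \<open>u v\<^sup>T M u v\<^sup>T\<close> is the scalar
  \<open>v\<^sup>T M u = tr (R M)\<close>. This is how the scalars \<open>q\<close> and \<open>Q\<close> of the proof arise from matrix equations.\<close>

lemma rank_one_sandwich:
  assumes "det R = 0" shows "R ** M ** R = trace (R ** M) *\<^sub>M R"
proof -
  have "R$1$1 * R$2$2 = R$1$2 * R$2$1" using assms by (simp add: det_2)
  then show ?thesis by (simp add: entrywise) algebra
qed

lemma nilpotent_det: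
  assumes "nilpotent_mat A" shows "det A = 0"
proof -
  have "det (((**) A ^^ n) (mat 1)) = det A ^ n" for n
    by (induction n) (simp_all add: det_mul)
  moreover obtain n where "((**) A ^^ n) (mat 1) = 0"
    using assms by (auto simp: nilpotent_mat_def)
  moreover have "det (0 :: cmat2) = 0" by (simp add: det_2)
  ultimately have "det A ^ n = 0" by metis
  then show ?thesis by simp
qed

lemma unimodular_adjugate:
  assumes "det X = 1"
  shows "X ** adjugate X = mat 1" "adjugate X ** X = mat 1"
proof -
  show "X ** adjugate X = mat 1" using assms by (simp add: adjugate_right)
  then show "adjugate X ** X = mat 1" using matrix_left_right_inverse by blast
qed

lemma matrix_inv_eq_adjugate:
  assumes "det X = 1" shows "matrix_inv X = adjugate X"
proof -
  have "matrix_inv X ** X = mat 1"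
    unfolding matrix_inv_def
    by (rule someI2[of _ "adjugate X"]) (use unimodular_adjugate[OF assms] in auto)
  then have "matrix_inv X ** (X ** adjugate X) = adjugate X" by (simp add: matrix_mul_assoc)
  then show ?thesis by (simp add: unimodular_adjugate[OF assms])
qed

section \<open>The moving frame of a nilpotent matrix\<close>

text \<open>If \<open>Y = c u (-b a)\<close> with \<open>u = (a, b)\<close>, then \<open>Y Y\<^sup>* / tr (Y Y\<^sup>*)\<close> is the orthogonal projection to
  the line of \<open>u\<close>. So \<open>normal_of Y\<close> is the reflection with eigenvalue \<open>-1\<close> on that line and \<open>1\<close> on its
  orthogonal complement; the sign is the one that the orientation requires.\<close>

definition normal_of :: "cmat2 \<Rightarrow> cmat2" where
  "normal_of Y = mat 1 - (2 / trace (Y ** cadjoint Y)) *\<^sub>M (Y ** cadjoint Y)"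

lemma trace_cadjoint_mult: "trace (Y ** cadjoint Y) = of_real ((norm Y)\<^sup>2)"
  by (simp add: entrywise norm_vec_def L2_set_def complex_norm_square flip: of_real_power)

lemma norm_cscale: "norm (c *\<^sub>M X) = norm c * norm X"
  by (simp add: norm_vec_def cscale_def norm_mult L2_set_right_distrib)

lemma trace_star_nonzero: "Y \<noteq> 0 \<Longrightarrow> trace (Y ** cadjoint Y) \<noteq> 0"
  by (simp add: trace_cadjoint_mult)

text \<open>The polarised Cayley-Hamilton identity: for trace-free \<open>X\<close> and \<open>Y\<close>, \<open>X Y + Y X\<close> is scalar.\<close>

lemma anticommutator_cadjoint:
  assumes "trace Y = 0"
  shows "Y ** cadjoint Y + cadjoint Y ** Y = trace (Y ** cadjoint Y) *\<^sub>M mat 1"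
proof -
  have "Y$2$2 = - Y$1$1" using assms by (simp add: trace_def sum_2 eq_neg_iff_add_eq_0 add.commute)
  then show ?thesis by (simp add: entrywise algebra_simps)
qed

lemma herm_inner_trace_free:
  assumes "trace y = 0" shows "herm_inner x y = Re (trace (x ** y)) / 2"
  using assms by (simp add: herm_inner_def adjugate_trace mult_diff_right trace_minus expand_mat)


lemma normal_of_mult:
  assumes "trace Y = 0" "det Y = 0" "Y \<noteq> 0"
  shows "normal_of Y ** Y = - Y" "Y ** normal_of Y = Y" "normal_of Y ** normal_of Y = mat 1"
proof -
  define t where "t = trace (Y ** cadjoint Y)"
  have t: "t \<noteq> 0" using trace_star_nonzero[OF assms(3)] by (simp add: t_def)
  have n: "normal_of Y = mat 1 - (2 / t) *\<^sub>M (Y ** cadjoint Y)" by (simp add: normal_of_def t_def)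
  have YY: "Y ** Y = 0" using square_trace_free assms by simp
  have "Y ** cadjoint Y ** Y = t *\<^sub>M Y" unfolding t_def by (rule rank_one_sandwich[OF assms(2)])
  then have "normal_of Y ** Y = Y - 2 *\<^sub>M Y" using t by (simp add: n expand_mat)
  then show 1: "normal_of Y ** Y = - Y" by (simp add: entrywise)
  show "Y ** normal_of Y = Y" by (simp add: n expand_mat YY)
  have "normal_of Y ** normal_of Y = normal_of Y - (2 / t) *\<^sub>M (normal_of Y ** Y ** cadjoint Y)"
    by (subst (2) n) (simp add: expand_mat)
  also have "\<dots> = normal_of Y + (2 / t) *\<^sub>M (Y ** cadjoint Y)" by (simp add: 1 expand_mat)
  finally show "normal_of Y ** normal_of Y = mat 1" by (simp add: n)
qed

lemma trace_normal_of: "Y \<noteq> 0 \<Longrightarrow> trace (normal_of Y) = 0"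
  using trace_star_nonzero by (simp add: normal_of_def trace_diff trace_mat1)

lemma hermitian_normal_of: "hermitian (normal_of Y)"
  by (simp add: hermitian_def normal_of_def cadjoint_diff cadjoint_mat1 cadjoint_mult
      cadjoint_cadjoint trace_cadjoint_mult)

text \<open>Real tangent vectors are of the form \<open>Y + Y\<^sup>*\<close>. The first term of the sum below is the complex
  bilinear pairing of the parts of type \<open>dz\<close>, the second the Hermitian pairing: in the
  second fundamental form they contribute the Hopf differential and the mean curvature.\<close>

lemma herm_inner_real_parts:
  assumes "trace Y = 0"
  shows "herm_inner (Z + cadjoint Z) (Y + cadjoint Y) = Re (trace (Y ** Z)) + Re (trace (Y ** cadjoint Z))"
proof -
  have "trace (cadjoint Z ** cadjoint Y) = cnj (trace (Y ** Z))"
    by (simp add: trace_cadjoint flip: cadjoint_mult)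
  moreover have "trace (Z ** cadjoint Y) = cnj (trace (Y ** cadjoint Z))"
    by (simp add: cadjoint_mult cadjoint_cadjoint flip: trace_cadjoint)
  moreover have "trace (Z ** Y) = trace (Y ** Z)" "trace (cadjoint Z ** Y) = trace (Y ** cadjoint Z)"
    by (rule trace_mul_sym)+
  ultimately show ?thesis using assms
    by (simp add: herm_inner_trace_free trace_add' trace_cadjoint expand_mat)
qed

text \<open>The first-order geometry of the immersions: here \<open>x\<close> and \<open>y\<close> are the derivatives in the two
  coordinate directions of a map with \<open>z\<close>-derivative \<open>Y\<close>. Conformality is \<open>tr (Y Y) = 0\<close>, and \<open>n\<close> is the
  positive normal because \<open>cross x y = Y\<^sup>* Y - Y Y\<^sup>* = tr (Y Y\<^sup>*) n\<close>.\<close>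

lemma nilpotent_frame:
  assumes "trace Y = 0" "det Y = 0" "Y \<noteq> 0"
  defines "x \<equiv> Y + cadjoint Y" and "y \<equiv> \<i> *\<^sub>M Y + cadjoint (\<i> *\<^sub>M Y)" and "n \<equiv> normal_of Y"
  shows "herm_inner x x = (norm Y)\<^sup>2" "herm_inner y y = (norm Y)\<^sup>2" "herm_inner x y = 0"
    "herm_inner n n = 1" "herm_inner n x = 0" "herm_inner n y = 0" "herm_inner (cross x y) n > 0"
proof -
  note t = trace_cadjoint_mult[of Y]
  have YY: "Y ** Y = 0" using square_trace_free assms by simp
  show "herm_inner x x = (norm Y)\<^sup>2"
    using assms(1) by (simp add: x_def herm_inner_real_parts YY t) (simp add: entrywise)
  show "herm_inner y y = (norm Y)\<^sup>2" unfolding y_def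
    by (subst herm_inner_real_parts) (use assms(1) in \<open>simp_all add: YY t, simp add: entrywise\<close>)
  show "herm_inner x y = 0" unfolding x_def y_def
    by (subst herm_inner_real_parts) (use assms(1) in \<open>simp_all add: YY t, simp add: entrywise\<close>)
  note N = normal_of_mult[OF assms(1-3), folded n_def]
  have n: "trace n = 0" "cadjoint n = n"
    using trace_normal_of assms(3) hermitian_normal_of by (auto simp: n_def hermitian_def)
  show nn: "herm_inner n n = 1" using n by (simp add: herm_inner_trace_free N trace_mat1)
  have "trace (n ** (v *\<^sub>M Y + cadjoint (v *\<^sub>M Y))) = 0" for v
  proof -
    have "n ** cadjoint Y = cadjoint Y" using arg_cong[OF N(2), of cadjoint] by (simp add: cadjoint_mult n)
    then show ?thesis using assms(1) by (simp add: expand_mat trace_add' N trace_minus trace_diff trace_cadjoint)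
  qed
  note z = this
  show "herm_inner n x = 0" "herm_inner n y = 0" using z[of 1] z[of \<i>] assms(1)
    by (simp_all add: x_def y_def herm_inner_trace_free trace_add' trace_cadjoint)
  have "x ** y - y ** x = (2 * \<i>) *\<^sub>M (cadjoint Y ** Y - Y ** cadjoint Y)"
    using YY arg_cong[OF YY, of cadjoint]
    by (simp add: x_def y_def expand_mat cadjoint_mult cscale_minus_left) (simp add: entrywise algebra_simps)
  then have "cross x y = cadjoint Y ** Y - Y ** cadjoint Y"
    by (simp add: cross_def mat_mult_eq_cscale)
  also have "\<dots> = (Y ** cadjoint Y + cadjoint Y ** Y) - 2 *\<^sub>M (Y ** cadjoint Y)"
    by (simp add: entrywise algebra_simps)
  also have "\<dots> = trace (Y ** cadjoint Y) *\<^sub>M n"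
    unfolding anticommutator_cadjoint[OF assms(1)] n_def normal_of_def
    using trace_star_nonzero[OF assms(3)] by (simp add: cscale_diff_right)
  finally have "cross x y = of_real ((norm Y)\<^sup>2) *\<^sub>M n" by (simp only: t)
  then have "herm_inner (cross x y) n = (norm Y)\<^sup>2 * herm_inner n n"
    by (simp add: herm_inner_def flip: of_real_power)
  then show "herm_inner (cross x y) n > 0" using nn assms(3) by simp
qed

text \<open>A matrix \<open>V\<close> that transports the tangent space at the base point, the trace-free Hermitian matrices,
  to the one at \<open>p\<close> via \<open>x \<mapsto> V x V\<^sup>*\<close>. It allows both space forms to be treated at once; the Euclidean
  tangent spaces are all the same.\<close>

definition adapted :: "space_form \<Rightarrow> cmat2 \<Rightarrow> cmat2 \<Rightarrow> bool" where
  "adapted S p V \<longleftrightarrow> det V = 1 \<and> (case S of Euclidean \<Rightarrow> V = mat 1 | Hyperbolic \<Rightarrow> p = V ** cadjoint V)"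

lemma
  assumes V: "adapted S (f z) V"
    and df: "(f has_derivative (\<lambda>v. V ** (v *\<^sub>M Y + cadjoint (v *\<^sub>M Y)) ** cadjoint V)) (at z)"
    and Y: "trace Y = 0" "det Y = 0" "Y \<noteq> 0"
  shows unit_normal_adapted: "unit_normal S f z (V ** normal_of Y ** cadjoint V)"
    and conformal_adapted: "herm_inner (differential f z 1) (differential f z 1) = (norm Y)\<^sup>2"
      "herm_inner (differential f z \<i>) (differential f z \<i>) = (norm Y)\<^sup>2"
      "herm_inner (differential f z 1) (differential f z \<i>) = 0"
proof -
  have d: "differential f z v = V ** (v *\<^sub>M Y + cadjoint (v *\<^sub>M Y)) ** cadjoint V" for v
    unfolding frechet_derivative_at[OF df, symmetric] by (rule refl)
  have V1: "det V = 1" using V by (simp add: adapted_def)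
  note tr = herm_inner_transport[OF V1]
  note F = nilpotent_frame[OF Y]
  show "herm_inner (differential f z 1) (differential f z 1) = (norm Y)\<^sup>2"
      "herm_inner (differential f z \<i>) (differential f z \<i>) = (norm Y)\<^sup>2"
      "herm_inner (differential f z 1) (differential f z \<i>) = 0"
    unfolding d tr cscale_one by (rule F)+
  have "herm_inner (normal_of Y) (mat 1) = 0"
    using trace_normal_of[OF Y(3)]
    by (subst herm_inner_commute) (simp add: herm_inner_trace_free)
  then have "herm_inner (V ** normal_of Y ** cadjoint V) (V ** mat 1 ** cadjoint V) = 0"
    unfolding tr .
  then have "herm_inner (V ** normal_of Y ** cadjoint V) (V ** cadjoint V) = 0" by simp
  moreover have "hermitian (V ** normal_of Y ** cadjoint V)"
    unfolding transport_herm[OF V1] by (rule hermitian_normal_of)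
  ultimately have "V ** normal_of Y ** cadjoint V \<in> tangent S (f z)"
    using V trace_normal_of[OF Y(3)]
    by (cases S) (simp_all add: adapted_def cadjoint_mat1)
  moreover have "positively_oriented S (f z) (differential f z 1) (differential f z \<i>) (V ** normal_of Y ** cadjoint V)"
  proof (cases S)
    case Euclidean
    then show ?thesis using V F(7) by (simp add: adapted_def d cadjoint_mat1)
  next
    case Hyperbolic
    then have "f z = V ** cadjoint V" using V by (simp add: adapted_def)
    then show ?thesis using V1 F(7) unfolding Hyperbolic positively_oriented.simps d cscale_one
      by (intro exI conjI) (rule refl | assumption)+
  qed
  ultimately show "unit_normal S f z (V ** normal_of Y ** cadjoint V)"
    unfolding unit_normal_def Let_def unfolding d tr cscale_one using F by blast
qed

text \<open>Up to transport the differentials of \<open>f\<close> and of its normal in the direction \<open>v\<close> are the real vectors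
  built from \<open>v Y\<close> and \<open>v Z\<close>. Their inner product consists of a term in \<open>v\<^sup>2\<close>, governed by
  \<open>tr (Y Z)\<close>, and a term in \<open>v cnj v\<close>, which can be absorbed into the mean curvature because the first
  fundamental form is \<open>(norm Y)\<^sup>2 v cnj v\<close>.\<close>

lemma has_hopf_differential_adapted:
  assumes W: "open W" "z \<in> W" "\<And>u. u \<in> W \<Longrightarrow> f u \<in> model_space S"
    and V: "\<And>u. u \<in> W \<Longrightarrow> adapted S (f u) (V u)"
    and df: "\<And>u. u \<in> W \<Longrightarrow>
      (f has_derivative (\<lambda>v. V u ** (v *\<^sub>M Y u + cadjoint (v *\<^sub>M Y u)) ** cadjoint (V u))) (at u)"
    and Y: "\<And>u. u \<in> W \<Longrightarrow> trace (Y u) = 0 \<and> det (Y u) = 0 \<and> Y u \<noteq> 0"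
    and dN: "((\<lambda>u. V u ** normal_of (Y u) ** cadjoint (V u)) has_derivative
      (\<lambda>v. V z ** (v *\<^sub>M Z + cadjoint (v *\<^sub>M Z)) ** cadjoint (V z))) (at z)"
    and Q: "trace (Y z ** Z) = - 2 * Q"
  shows "has_hopf_differential S f z Q"
proof -
  let ?N = "\<lambda>u. V u ** normal_of (Y u) ** cadjoint (V u)"
  \<comment> \<open>The mean curvature is \<open>-\<rho> / (norm (Y z))\<^sup>2\<close>.\<close>
  define \<rho> where "\<rho> = Re (trace (Y z ** cadjoint Z))"
  have V1: "det (V z) = 1" using V[OF W(2)] by (simp add: adapted_def)
  note tr = herm_inner_transport[OF V1]
  have fz: "differential f z v = V z ** (v *\<^sub>M Y z + cadjoint (v *\<^sub>M Y z)) ** cadjoint (V z)" for v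
    unfolding frechet_derivative_at[OF df[OF W(2)], symmetric] by (rule refl)
  have Nz: "differential ?N z v = V z ** (v *\<^sub>M Z + cadjoint (v *\<^sub>M Z)) ** cadjoint (V z)" for v
    unfolding frechet_derivative_at[OF dN, symmetric] by (rule refl)
  have Yz: "trace (Y z) = 0" "det (Y z) = 0" "Y z \<noteq> 0" using Y[OF W(2)] by auto
  have YY: "Y z ** Y z = 0" using square_trace_free Yz by simp
  have conf: "conformal_immersion_on S W f"
    unfolding conformal_immersion_on_def Let_def
  proof (intro ballI conjI)
    fix u assume u: "u \<in> W"
    note c = conformal_adapted[of S f u "V u" "Y u", OF V[OF u] df[OF u]]
    show "f u \<in> model_space S" by (rule W(3)[OF u])
    show "f differentiable (at u)" using df[OF u] by (rule differentiableI)
    show "herm_inner (differential f u 1) (differential f u 1) = herm_inner (differential f u \<i>) (differential f u \<i>)"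
      "herm_inner (differential f u 1) (differential f u 1) > 0"
      "herm_inner (differential f u 1) (differential f u \<i>) = 0"
      using Y[OF u] c by simp_all
  qed
  have normal: "unit_normal S f u (?N u)" if "u \<in> W" for u
    by (rule unit_normal_adapted[of S f u "V u" "Y u", OF V[OF that] df[OF that]]) (use Y[OF that] in simp_all)
  have "complex_of_real (- herm_inner (differential f z v) (differential ?N z v)) =
      Q * v\<^sup>2 + complex_of_real (- \<rho> / (norm (Y z))\<^sup>2 * herm_inner (differential f z v) (differential f z v)) +
      cnj Q * (cnj v)\<^sup>2" for v
  proof -
    have 0: "trace ((v *\<^sub>M Y z) ** v *\<^sub>M X) = v\<^sup>2 * trace (Y z ** X)"
      "trace ((v *\<^sub>M Y z) ** cadjoint (v *\<^sub>M X)) = of_real ((norm v)\<^sup>2) * trace (Y z ** cadjoint X)" for X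
      unfolding complex_norm_square by (simp_all add: power2_eq_square)
    have vY: "trace (v *\<^sub>M Y z) = 0" using Yz by simp
    have 1: "herm_inner (differential f z v) (differential f z v) = (norm v)\<^sup>2 * (norm (Y z))\<^sup>2"
      unfolding fz tr herm_inner_real_parts[OF vY] 0 YY trace_cadjoint_mult
      by (simp add: trace_def norm_cscale power_mult_distrib del: of_real_power)
    have 2: "herm_inner (differential f z v) (differential ?N z v) = - 2 * Re (Q * v\<^sup>2) + (norm v)\<^sup>2 * \<rho>"
      unfolding fz Nz tr
      by (subst herm_inner_commute)
        (simp only: herm_inner_real_parts[OF vY] 0 Q \<rho>_def, simp add: mult.commute del: of_real_power)
    have 3: "- \<rho> / (norm (Y z))\<^sup>2 * ((norm v)\<^sup>2 * (norm (Y z))\<^sup>2) = - ((norm v)\<^sup>2 * \<rho>)"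
      using Yz(3) by simp
    have 4: "cnj Q * (cnj v)\<^sup>2 = of_real (2 * Re (Q * v\<^sup>2)) - Q * v\<^sup>2"
      unfolding complex_add_cnj[symmetric] by simp
    show ?thesis unfolding 1 2 3 4 by simp
  qed
  then have H: "\<exists>H::real. \<forall>v. complex_of_real (- herm_inner (differential f z v) (differential ?N z v)) =
      Q * v\<^sup>2 + complex_of_real (H * herm_inner (differential f z v) (differential f z v)) + cnj Q * (cnj v)\<^sup>2"
    by blast
  have dN': "?N differentiable (at z)" using dN by (rule differentiableI)
  show ?thesis unfolding has_hopf_differential_def
    by (rule exI[of _ W], rule exI[of _ ?N], intro conjI ballI) (rule W(1,2) conf dN' H | erule normal)+
qed


section \<open>Calculus of matrix functions\<close>

text \<open>Complex differentiability, phrased through the real derivative so that it combines with the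
  antiholomorphic factors \<open>Y\<^sup>*\<close> in the immersions and normals.\<close>

definition has_mat_deriv :: "(complex \<Rightarrow> cmat2) \<Rightarrow> cmat2 \<Rightarrow> complex \<Rightarrow> bool" where
  "has_mat_deriv F D z \<longleftrightarrow> (F has_derivative (\<lambda>v. v *\<^sub>M D)) (at z)"

lemma bounded_bilinear_mat_mult: "bounded_bilinear ((**) :: cmat2 \<Rightarrow> cmat2 \<Rightarrow> cmat2)"
  and bounded_bilinear_cscale: "bounded_bilinear (*\<^sub>M)"
  and bounded_linear_adjugate: "bounded_linear adjugate"
  and bounded_linear_trace: "bounded_linear (trace :: cmat2 \<Rightarrow> complex)"
proof -
  have "bilinear ((**) :: cmat2 \<Rightarrow> cmat2 \<Rightarrow> cmat2)" "bilinear (*\<^sub>M)"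
    unfolding bilinear_def by (auto intro!: linearI simp: entrywise algebra_simps)
  then show "bounded_bilinear ((**) :: cmat2 \<Rightarrow> cmat2 \<Rightarrow> cmat2)" "bounded_bilinear (*\<^sub>M)"
    by (simp_all add: bilinear_conv_bounded_bilinear)
  show "bounded_linear adjugate" "bounded_linear (trace :: cmat2 \<Rightarrow> complex)"
    by (intro linear_conv_bounded_linear[THEN iffD1] linearI; simp add: entrywise algebra_simps)+
qed

lemma has_mat_deriv_mult:
  assumes "has_mat_deriv F F' z" "has_mat_deriv G G' z"
  shows "has_mat_deriv (\<lambda>u. F u ** G u) (F z ** G' + F' ** G z) z"
  using bounded_bilinear.FDERIV[OF bounded_bilinear_mat_mult assms[unfolded has_mat_deriv_def]]
  by (simp add: has_mat_deriv_def cscale_add_right)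

lemma has_mat_deriv_diff:
  assumes "has_mat_deriv F F' z" "has_mat_deriv G G' z"
  shows "has_mat_deriv (\<lambda>u. F u - G u) (F' - G') z"
  using has_derivative_diff[OF assms[unfolded has_mat_deriv_def]]
  by (simp add: has_mat_deriv_def cscale_diff_right)

lemma has_mat_deriv_cscale:
  assumes "has_mat_deriv F F' z"
  shows "has_mat_deriv (\<lambda>u. c *\<^sub>M F u) (c *\<^sub>M F') z"
  using bounded_linear.has_derivative[OF bounded_bilinear.bounded_linear_right[OF bounded_bilinear_cscale]
      assms[unfolded has_mat_deriv_def], of c]
  by (simp add: has_mat_deriv_def mult.commute)

lemma has_mat_deriv_const: "has_mat_deriv (\<lambda>u. c) 0 z"
  by (simp add: has_mat_deriv_def)

lemma has_mat_deriv_adjugate: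
  assumes "has_mat_deriv F F' z"
  shows "has_mat_deriv (\<lambda>u. adjugate (F u)) (adjugate F') z"
  using bounded_linear.has_derivative[OF bounded_linear_adjugate assms[unfolded has_mat_deriv_def]]
  by (simp add: has_mat_deriv_def adjugate_cscale)

lemma has_derivative_cadjoint:
  assumes "has_mat_deriv F F' z"
  shows "((\<lambda>u. cadjoint (F u)) has_derivative (\<lambda>v. cadjoint (v *\<^sub>M F'))) (at z)"
  by (rule bounded_linear.has_derivative[OF bounded_linear_cadjoint assms[unfolded has_mat_deriv_def]])

lemma has_mat_deriv_unique:
  assumes "has_mat_deriv F D z" "has_mat_deriv F D' z" shows "D = D'"
proof -
  have "(\<lambda>v. v *\<^sub>M D) = (\<lambda>v. v *\<^sub>M D')"
    using assms unfolding has_mat_deriv_def by (rule has_derivative_unique)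
  from fun_cong[OF this, of 1] show ?thesis by simp
qed

lemma has_mat_deriv_transform:
  assumes "has_mat_deriv F D z" "open W" "z \<in> W" "\<And>u. u \<in> W \<Longrightarrow> F u = G u"
  shows "has_mat_deriv G D z"
  using assms unfolding has_mat_deriv_def by (blast intro: has_derivative_transform_within_open)

lemma has_mat_deriv_continuous: "has_mat_deriv F D z \<Longrightarrow> isCont F z"
  unfolding has_mat_deriv_def by (rule has_derivative_continuous)

lemma holomorphic_has_mat_deriv:
  assumes "holomorphic_mat_on F U" "open U" "z \<in> U"
  shows "has_mat_deriv F (deriv_mat F z) z"
proof -
  \<comment> \<open>The elementary matrices reduce the claim to the four entries.\<close>
  define E :: "2 \<Rightarrow> 2 \<Rightarrow> cmat2" where "E i j = (\<chi> i' j'. if i' = i \<and> j' = j then 1 else 0)" for i j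
  have dec: "X = (\<Sum>i\<in>UNIV. \<Sum>j\<in>UNIV. (X $ i $ j) *\<^sub>M E i j)" for X
    by (simp add: E_def entrywise)
  have "((\<lambda>u. F u $ i $ j) has_derivative (\<lambda>v. deriv_mat F z $ i $ j * v)) (at z)" for i j
    using holomorphic_derivI[of "\<lambda>u. F u $ i $ j" U z] assms
    by (simp add: holomorphic_mat_on_def has_field_derivative_def deriv_mat_def)
  then have "((\<lambda>u. \<Sum>i\<in>UNIV. \<Sum>j\<in>UNIV. (F u $ i $ j) *\<^sub>M E i j) has_derivative
      (\<lambda>v. \<Sum>i\<in>UNIV. \<Sum>j\<in>UNIV. (deriv_mat F z $ i $ j * v) *\<^sub>M E i j)) (at z)"
    by (intro has_derivative_sum
        bounded_linear.has_derivative[OF bounded_bilinear.bounded_linear_left[OF bounded_bilinear_cscale]])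
  moreover have "(\<Sum>i\<in>UNIV. \<Sum>j\<in>UNIV. (deriv_mat F z $ i $ j * v) *\<^sub>M E i j) = v *\<^sub>M deriv_mat F z" for v
    by (subst (2) dec) (simp add: sum_2 cscale_add_right mult.commute)
  ultimately show ?thesis
    unfolding has_mat_deriv_def dec[symmetric] by simp
qed

text \<open>The logarithmic derivative of a curve in \<open>SL\<^sub>2\<close> is trace-free; the proof differentiates
  \<open>F adj F = 1\<close>, whose two summands have the same trace.\<close>

lemma trace_deriv_unimodular:
  assumes F: "has_mat_deriv F D z" and W: "open W" "z \<in> W" "\<And>u. u \<in> W \<Longrightarrow> det (F u) = 1"
  shows "trace (D ** adjugate (F z)) = 0"
proof -
  have "has_mat_deriv (\<lambda>u. F u ** adjugate (F u)) (F z ** adjugate D + D ** adjugate (F z)) z"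
    by (intro has_mat_deriv_mult has_mat_deriv_adjugate F)
  moreover have "has_mat_deriv (\<lambda>u. F u ** adjugate (F u)) 0 z"
    by (rule has_mat_deriv_transform[OF has_mat_deriv_const[of "mat 1"] W(1,2)])
       (simp add: adjugate_right W(3))
  ultimately have "F z ** adjugate D + D ** adjugate (F z) = 0" by (rule has_mat_deriv_unique)
  then have "trace (F z ** adjugate D + D ** adjugate (F z)) = 0" by (simp add: trace_def)
  moreover have "trace (F z ** adjugate D) = trace (D ** adjugate (F z))"
    by (simp add: entrywise algebra_simps)
  ultimately show ?thesis by (simp add: trace_add')
qed

text \<open>An elementary substitute for Gronwall's inequality. On a disc so small that \<open>k r \<le> 1/2\<close> the maximum
  \<open>m\<close> of \<open>norm X\<close> satisfies \<open>m \<le> norm (X z0) + r (k m + e)\<close> by the mean value inequality, and the term in \<open>m\<close> on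
  the right is at most half of the left-hand side.\<close>

lemma linear_growth_bound:
  fixes X :: "complex \<Rightarrow> 'a::real_normed_vector"
  assumes dX: "\<And>u. u \<in> cball z0 r \<Longrightarrow> (X has_derivative X' u) (at u)"
    and bd: "\<And>u h. u \<in> cball z0 r \<Longrightarrow> norm (X' u h) \<le> (k * norm (X u) + e) * norm h"
    and r: "r > 0" "k * r \<le> 1/2" "k \<ge> 0" "e \<ge> 0" and u: "u \<in> cball z0 r"
  shows "norm (X u) \<le> 2 * norm (X z0) + 2 * r * e"
proof -
  have cont: "continuous_on (cball z0 r) (\<lambda>u. norm (X u))"
    using dX by (intro continuous_on_norm has_derivative_continuous_on) (blast intro: has_derivative_at_withinI)
  obtain w where w: "w \<in> cball z0 r" "\<And>y. y \<in> cball z0 r \<Longrightarrow> norm (X y) \<le> norm (X w)"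
    using continuous_attains_sup[OF compact_cball _ cont] r by force
  have "norm (X w - X z0) \<le> (k * norm (X w) + e) * norm (w - z0)"
  proof (rule differentiable_bound[of "cball z0 r" X X'])
    fix y assume y: "y \<in> cball z0 r"
    show "(X has_derivative X' y) (at y within cball z0 r)"
      using dX[OF y] by (rule has_derivative_at_withinI)
    have "norm (X' y h) \<le> (k * norm (X w) + e) * norm h" for h
      using bd[OF y, of h] w(2)[OF y] r(3)
      by (smt (verit) mult_left_mono mult_right_mono norm_ge_zero)
    then show "onorm (X' y) \<le> k * norm (X w) + e" by (rule onorm_bound[rotated]) (use r in simp)
  qed (use w r in auto)
  also have "\<dots> \<le> (k * norm (X w) + e) * r"
    using w(1) r by (intro mult_left_mono) (auto simp: dist_norm norm_minus_commute)
  also have "\<dots> = k * r * norm (X w) + r * e" by (simp add: algebra_simps)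
  also have "\<dots> \<le> 1/2 * norm (X w) + r * e" using r by (intro add_right_mono mult_right_mono) auto
  finally have "norm (X w) \<le> norm (X z0) + 1/2 * norm (X w) + r * e"
    using norm_triangle_sub[of "X w" "X z0"] by linarith
  then show ?thesis using w(2)[OF u] by linarith
qed

section \<open>Derivatives of a loop Weierstrass frame\<close>

lemma lwr_frame_has_mat_deriv:
  assumes "lwr_frame U A B \<Phi>" "open U" "z \<in> U"
  shows "has_mat_deriv (\<lambda>u. \<Phi> u l) (\<Phi> z l ** (l *\<^sub>M A z + B z)) z"
proof -
  have d: "det (\<Phi> z l) = 1" and "matrix_inv (\<Phi> z l) ** deriv_mat (\<lambda>u. \<Phi> u l) z = mat l ** A z + B z"
    using assms by (auto simp: lwr_frame_def)
  then have "\<Phi> z l ** (adjugate (\<Phi> z l) ** deriv_mat (\<lambda>u. \<Phi> u l) z) = \<Phi> z l ** (l *\<^sub>M A z + B z)"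
    by (simp add: matrix_inv_eq_adjugate mat_mult_eq_cscale)
  then have "deriv_mat (\<lambda>u. \<Phi> u l) z = \<Phi> z l ** (l *\<^sub>M A z + B z)"
    by (simp add: matrix_mul_assoc unimodular_adjugate[OF d])
  moreover have "has_mat_deriv (\<lambda>u. \<Phi> u l) (deriv_mat (\<lambda>u. \<Phi> u l) z) z"
    using assms by (intro holomorphic_has_mat_deriv[of _ U]) (auto simp: lwr_frame_def)
  ultimately show ?thesis by simp
qed

lemma lwr_frame_inverse_has_mat_deriv:
  assumes "lwr_frame U A B \<Phi>" "open U" "z \<in> U"
  shows "has_mat_deriv (\<lambda>u. adjugate (\<Phi> u l)) (- ((l *\<^sub>M A z + B z) ** adjugate (\<Phi> z l))) z"
proof -
  have "trace (l *\<^sub>M A z + B z) = 0"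
    using assms by (auto simp: lwr_frame_def lwr_potential_def trace_add')
  then have "adjugate (l *\<^sub>M A z + B z) = - (l *\<^sub>M A z + B z)" by (simp add: adjugate_trace)
  then show ?thesis
    using has_mat_deriv_adjugate[OF lwr_frame_has_mat_deriv[OF assms], of l]
    by (simp only: adjugate_mult mult_minus_left)
qed

lemma lwr_potential_has_mat_deriv:
  assumes "lwr_frame U A B \<Phi>" "open U" "z \<in> U"
  shows "has_mat_deriv A (deriv_mat A z) z" "has_mat_deriv B (deriv_mat B z) z"
  by (rule holomorphic_has_mat_deriv[OF _ assms(2,3)],
      use assms(1) in \<open>simp add: lwr_frame_def lwr_potential_def\<close>)+

text \<open>The Euclidean immersion involves the derivative of the frame in the spectral parameter, which has to be
  differentiated in \<open>z\<close>. A frame is holomorphic in each variable separately, so interchanging the two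
  derivatives needs an argument. The derivative in \<open>l\<close> is the limit of the difference quotients
  \<open>(\<Phi>\<^sub>l - \<Phi>\<^sub>l\<^sub>0) \<Phi>\<^sub>l\<^sub>0\<^sup>-\<^sup>1 / (l - l0)\<close>, whose \<open>z\<close>-derivatives are
  \<open>\<Phi>\<^sub>l A \<Phi>\<^sub>l\<^sub>0\<^sup>-\<^sup>1\<close>. These converge uniformly near \<open>z0\<close>, because the difference \<open>E = \<Phi>\<^sub>l - \<Phi>\<^sub>l\<^sub>0\<close>
  solves the linear equation \<open>E' = E (l A + B) + (l - l0) \<Phi>\<^sub>l\<^sub>0 A\<close> with a small initial value and a small
  inhomogeneous term.\<close>

lemma spectral_derivative_has_mat_deriv:
  assumes \<Phi>: "lwr_frame U A B \<Phi>" and U: "open U" "z0 \<in> U"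
  shows "has_mat_deriv (\<lambda>u. deriv_mat (\<Phi> u) l0 ** adjugate (\<Phi> u l0))
      (\<Phi> z0 l0 ** A z0 ** adjugate (\<Phi> z0 l0)) z0"
proof -
  obtain K where K: "K > 0" "\<And>(X :: cmat2) (Y :: cmat2). norm (X ** Y) \<le> norm X * norm Y * K"
    using bounded_bilinear.pos_bounded[OF bounded_bilinear_mat_mult] by blast
  obtain r0 where r0: "r0 > 0" "cball z0 r0 \<subseteq> U" using open_contains_cball_eq[OF U(1)] U(2) by metis
  have bounded: "\<exists>m\<ge>0. \<forall>u\<in>cball z0 r0. norm (F u) \<le> m"
    if "\<And>u. u \<in> U \<Longrightarrow> isCont F u" for F :: "complex \<Rightarrow> cmat2"
  proof -
    have "\<forall>u\<in>cball z0 r0. isCont F u" using that r0(2) by blast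
    then have "continuous_on (cball z0 r0) F" by (rule continuous_at_imp_continuous_on)
    then have "bounded (F ` cball z0 r0)" by (intro compact_imp_bounded compact_continuous_image) auto
    then obtain m where "m > 0" "\<forall>x\<in>F ` cball z0 r0. norm x \<le> m" unfolding bounded_pos by (elim exE conjE)
    then show ?thesis by (intro exI[of _ m] conjI ballI) (simp_all add: less_imp_le)
  qed
  note dA = lwr_potential_has_mat_deriv[OF \<Phi> U(1), THEN has_mat_deriv_continuous]
  obtain a where a: "a \<ge> 0" "\<And>u. u \<in> cball z0 r0 \<Longrightarrow> norm (A u) \<le> a" using bounded[OF dA(1)] by blast
  obtain b where b: "b \<ge> 0" "\<And>u. u \<in> cball z0 r0 \<Longrightarrow> norm (B u) \<le> b" using bounded[OF dA(2)] by blast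
  note dP = lwr_frame_has_mat_deriv[OF \<Phi> U(1)] and dI = lwr_frame_inverse_has_mat_deriv[OF \<Phi> U(1)]
  obtain p where p: "p \<ge> 0" "\<And>u. u \<in> cball z0 r0 \<Longrightarrow> norm (\<Phi> u l0) \<le> p"
    using bounded[OF has_mat_deriv_continuous[OF dP[of _ l0]]] by blast
  obtain q where q: "q \<ge> 0" "\<And>u. u \<in> cball z0 r0 \<Longrightarrow> norm (adjugate (\<Phi> u l0)) \<le> q"
    using bounded[OF has_mat_deriv_continuous[OF dI[of _ l0]]] by blast
  \<comment> \<open>A bound for the coefficient \<open>l A + B\<close>, uniform for \<open>l\<close> within distance \<open>1\<close> of \<open>l0\<close>.\<close>
  define k where "k = ((norm l0 + 1) * a + b) * K"
  have k: "k \<ge> 0" using a(1) b(1) K by (simp add: k_def)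
  define r where "r = min r0 (1 / (2 * (k + 1)))"
  have r: "r > 0" "k * r \<le> 1/2" "cball z0 r \<subseteq> cball z0 r0"
  proof -
    show "r > 0" using r0 k by (simp add: r_def)
    have "k * r \<le> k * (1 / (2 * (k + 1)))" using k by (intro mult_left_mono) (simp_all add: r_def)
    also have "\<dots> \<le> 1/2" using k by (simp add: field_simps)
    finally show "k * r \<le> 1/2" .
    show "cball z0 r \<subseteq> cball z0 r0" by (rule subset_cball) (simp add: r_def)
  qed
  have in_U: "u \<in> U" if "u \<in> cball z0 r" for u using that r r0 by blast
  define d where "d n = inverse (real (Suc n))" for n
  have d: "d \<longlonglongrightarrow> 0" unfolding d_def by (rule LIMSEQ_inverse_real_of_nat)
  have d0: "(\<lambda>n. complex_of_real (d n)) \<longlonglongrightarrow> 0" using tendsto_of_real[OF d] by simp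
  have dpos: "d n > 0" "d n \<le> 1" for n by (simp_all add: d_def inverse_eq_divide)
  define L where "L n = l0 + of_real (d n)" for n
  have L: "L \<longlonglongrightarrow> l0" "L n \<noteq> l0" for n
    using tendsto_add[OF tendsto_const[of l0] d0] dpos(1)[of n] by (simp_all add: L_def[abs_def])
  have dl: "has_mat_deriv (\<Phi> u) (deriv_mat (\<Phi> u) l0) l0" if "u \<in> U" for u
    using \<Phi> that by (intro holomorphic_has_mat_deriv[of _ UNIV]) (auto simp: lwr_frame_def)
  define e where "e n = 2 * norm (\<Phi> z0 (L n) - \<Phi> z0 l0) + 2 * r * (d n * p * a * K)" for n
  have "(\<lambda>n. \<Phi> z0 (L n)) \<longlonglongrightarrow> \<Phi> z0 l0"
    using has_mat_deriv_continuous[OF dl[OF U(2)]] L(1) by (rule isCont_tendsto_compose)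
  with d have "e \<longlonglongrightarrow> 2 * norm (\<Phi> z0 l0 - \<Phi> z0 l0) + 2 * r * (0 * p * a * K)"
    unfolding e_def by (intro tendsto_add tendsto_mult tendsto_norm tendsto_diff tendsto_const)
  then have e: "e \<longlonglongrightarrow> 0" by simp
  have unif: "norm (\<Phi> u (L n) - \<Phi> u l0) \<le> e n" if u: "u \<in> cball z0 r" for u n
    unfolding e_def
  proof (rule linear_growth_bound[OF _ _ r(1,2) k _ u])
    fix w assume w: "w \<in> cball z0 r"
    let ?C = "L n *\<^sub>M A w + B w"
    have "\<Phi> w (L n) ** ?C - \<Phi> w l0 ** (l0 *\<^sub>M A w + B w) =
        (\<Phi> w (L n) - \<Phi> w l0) ** ?C + of_real (d n) *\<^sub>M (\<Phi> w l0 ** A w)"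
      by (simp add: L_def cscale_add_left expand_mat)
    then show "((\<lambda>u. \<Phi> u (L n) - \<Phi> u l0) has_derivative
        (\<lambda>h. h *\<^sub>M ((\<Phi> w (L n) - \<Phi> w l0) ** ?C + of_real (d n) *\<^sub>M (\<Phi> w l0 ** A w)))) (at w)"
      using has_mat_deriv_diff[OF dP dP, OF in_U[OF w] in_U[OF w], of "L n" l0]
      by (simp add: has_mat_deriv_def)
    fix h
    have "norm (L n) \<le> norm l0 + 1"
      using norm_triangle_ineq[of l0 "of_real (d n)"] dpos[of n] by (simp add: L_def)
    then have "norm (L n) * norm (A w) \<le> (norm l0 + 1) * a" 
      using a w r(3) by (intro mult_mono) auto
    then have "norm ?C \<le> (norm l0 + 1) * a + b"
      using b(2)[of w] w r(3) norm_triangle_ineq[of "L n *\<^sub>M A w" "B w"] by (auto simp: norm_cscale)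
    then have "norm (\<Phi> w (L n) - \<Phi> w l0) * norm ?C * K \<le> norm (\<Phi> w (L n) - \<Phi> w l0) * ((norm l0 + 1) * a + b) * K"
      using K by (intro mult_right_mono mult_left_mono) auto
    then have 1: "norm ((\<Phi> w (L n) - \<Phi> w l0) ** ?C) \<le> k * norm (\<Phi> w (L n) - \<Phi> w l0)"
      using K(2)[of "\<Phi> w (L n) - \<Phi> w l0" ?C] by (simp add: k_def mult_ac)
    have "norm (\<Phi> w l0) * norm (A w) * K \<le> p * a * K"
      using a p w r(3) K by (intro mult_mono) auto
    then have "norm (\<Phi> w l0 ** A w) \<le> p * a * K" using K(2)[of "\<Phi> w l0" "A w"] by linarith
    then have 2: "norm (of_real (d n) *\<^sub>M (\<Phi> w l0 ** A w)) \<le> d n * p * a * K"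
      using dpos[of n] mult_left_mono[of "norm (\<Phi> w l0 ** A w)" "p * a * K" "d n"]
      by (simp add: norm_cscale mult.assoc)
    have "norm ((\<Phi> w (L n) - \<Phi> w l0) ** ?C + of_real (d n) *\<^sub>M (\<Phi> w l0 ** A w))
        \<le> k * norm (\<Phi> w (L n) - \<Phi> w l0) + d n * p * a * K"
      using norm_triangle_mono[OF 1 2] .
    from mult_right_mono[OF this norm_ge_zero[of h]]
    show "norm (h *\<^sub>M ((\<Phi> w (L n) - \<Phi> w l0) ** ?C + of_real (d n) *\<^sub>M (\<Phi> w l0 ** A w)))
        \<le> (k * norm (\<Phi> w (L n) - \<Phi> w l0) + d n * p * a * K) * norm h"
      by (simp only: norm_cscale mult.commute)
  qed (use dpos[of n] a p K in simp)
  define F where "F n u = (1 / of_real (d n)) *\<^sub>M ((\<Phi> u (L n) - \<Phi> u l0) ** adjugate (\<Phi> u l0))" for n u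
  define D where "D n u = \<Phi> u (L n) ** A u ** adjugate (\<Phi> u l0)" for n u
  define D0 where "D0 u = \<Phi> u l0 ** A u ** adjugate (\<Phi> u l0)" for u
  have dF: "has_mat_deriv (F n) (D n u) u" if u: "u \<in> U" for n u
  proof -
    have "has_mat_deriv (F n) ((1 / of_real (d n)) *\<^sub>M
        ((\<Phi> u (L n) - \<Phi> u l0) ** (- ((l0 *\<^sub>M A u + B u) ** adjugate (\<Phi> u l0))) +
         (\<Phi> u (L n) ** (L n *\<^sub>M A u + B u) - \<Phi> u l0 ** (l0 *\<^sub>M A u + B u)) ** adjugate (\<Phi> u l0))) u"
      unfolding F_def
      by (rule has_mat_deriv_cscale[OF has_mat_deriv_mult[OF has_mat_deriv_diff[OF dP[OF u] dP[OF u]] dI[OF u]]])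
    also have "(1 / of_real (d n)) *\<^sub>M
        ((\<Phi> u (L n) - \<Phi> u l0) ** (- ((l0 *\<^sub>M A u + B u) ** adjugate (\<Phi> u l0))) +
         (\<Phi> u (L n) ** (L n *\<^sub>M A u + B u) - \<Phi> u l0 ** (l0 *\<^sub>M A u + B u)) ** adjugate (\<Phi> u l0)) = D n u"
      using dpos(1)[of n] by (simp add: D_def L_def expand_mat cscale_add_left)
    finally show ?thesis .
  qed
  have limF: "(\<lambda>n. F n u) \<longlonglongrightarrow> deriv_mat (\<Phi> u) l0 ** adjugate (\<Phi> u l0)" if u: "u \<in> U" for u
  proof -
    have "(\<lambda>n. (1 / of_real (d n)) *\<^sub>M (\<Phi> u (L n) - \<Phi> u l0)) \<longlonglongrightarrow> deriv_mat (\<Phi> u) l0"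
    proof (intro vec_tendstoI)
      fix i j
      have "(\<lambda>l. \<Phi> u l $ i $ j) holomorphic_on UNIV"
        using \<Phi> u by (auto simp: lwr_frame_def holomorphic_mat_on_def)
      then have "((\<lambda>l. \<Phi> u l $ i $ j) has_field_derivative deriv_mat (\<Phi> u) l0 $ i $ j) (at l0)"
        using holomorphic_derivI[of "\<lambda>l. \<Phi> u l $ i $ j" UNIV l0] by (simp add: deriv_mat_def)
      then have "((\<lambda>l. (\<Phi> u l $ i $ j - \<Phi> u l0 $ i $ j) / (l - l0)) \<longlongrightarrow> deriv_mat (\<Phi> u) l0 $ i $ j) (at l0)"
        by (simp add: has_field_derivative_iff)
      moreover have "filterlim L (at l0) sequentially"
        using L by (intro filterlim_atI) auto
      ultimately have "(\<lambda>n. (\<Phi> u (L n) $ i $ j - \<Phi> u l0 $ i $ j) / (L n - l0)) \<longlonglongrightarrow> deriv_mat (\<Phi> u) l0 $ i $ j"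
        by (rule filterlim_compose)
      then show "(\<lambda>n. ((1 / of_real (d n)) *\<^sub>M (\<Phi> u (L n) - \<Phi> u l0)) $ i $ j) \<longlonglongrightarrow> deriv_mat (\<Phi> u) l0 $ i $ j"
        by (simp add: cscale_def L_def)
    qed
    from bounded_bilinear.tendsto[OF bounded_bilinear_mat_mult this tendsto_const[of "adjugate (\<Phi> u l0)"]]
    show ?thesis by (simp add: F_def)
  qed
  have "\<exists>g. \<forall>u\<in>ball z0 r. (\<lambda>n. F n u) \<longlonglongrightarrow> g u \<and> (g has_derivative (\<lambda>h. h *\<^sub>M D0 u)) (at u within ball z0 r)"
  proof (rule has_derivative_sequence[where f' = "\<lambda>n u h. h *\<^sub>M D n u"])
    show "(F n has_derivative (\<lambda>h. h *\<^sub>M D n u)) (at u within ball z0 r)" if "u \<in> ball z0 r" for n u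
      using dF[of u n] in_U[of u] that by (auto simp: has_mat_deriv_def intro: has_derivative_at_withinI)
    show "z0 \<in> ball z0 r" using r by simp
    show "(\<lambda>n. F n z0) \<longlonglongrightarrow> deriv_mat (\<Phi> z0) l0 ** adjugate (\<Phi> z0 l0)" by (rule limF[OF U(2)])
    fix \<epsilon> :: real assume \<epsilon>: "\<epsilon> > 0"
    have "(\<lambda>n. e n * a * K * q * K) \<longlonglongrightarrow> 0 * a * K * q * K" by (intro tendsto_mult tendsto_const e)
    then have "\<forall>\<^sub>F n in sequentially. e n * a * K * q * K < \<epsilon>"
      using \<epsilon> by (simp add: order_tendstoD(2))
    then show "\<forall>\<^sub>F n in sequentially. \<forall>u\<in>ball z0 r. \<forall>h. norm (h *\<^sub>M D n u - h *\<^sub>M D0 u) \<le> \<epsilon> * norm h"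
    proof (rule eventually_mono, intro ballI allI)
      fix n u h assume n: "e n * a * K * q * K < \<epsilon>" and "u \<in> ball z0 r"
      then have u: "u \<in> cball z0 r" by simp
      then have u0: "u \<in> cball z0 r0" using r(3) by blast
      have e0: "0 \<le> e n" using order_trans[OF norm_ge_zero unif[OF u, of n]]  .
      let ?E = "\<Phi> u (L n) - \<Phi> u l0"
      have "norm (?E ** A u ** adjugate (\<Phi> u l0)) \<le> norm (?E ** A u) * norm (adjugate (\<Phi> u l0)) * K"
        by (rule K)
      also have "\<dots> \<le> (norm ?E * norm (A u) * K) * norm (adjugate (\<Phi> u l0)) * K"
        using K by (intro mult_right_mono) auto
      also have "\<dots> \<le> (e n * a * K) * q * K"
        using K(1) a(1) a(2)[OF u0] q(1) q(2)[OF u0] e0 unif[OF u, of n] by (intro mult_mono mult_nonneg_nonneg) auto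
      finally have "norm (?E ** A u ** adjugate (\<Phi> u l0)) \<le> \<epsilon>" using n by simp
      moreover have "h *\<^sub>M D n u - h *\<^sub>M D0 u = h *\<^sub>M (?E ** A u ** adjugate (\<Phi> u l0))"
        by (simp add: D_def D0_def expand_mat)
      ultimately show "norm (h *\<^sub>M D n u - h *\<^sub>M D0 u) \<le> \<epsilon> * norm h"
        using mult_left_mono[of "norm (?E ** A u ** adjugate (\<Phi> u l0))" \<epsilon> "norm h"]
        by (simp add: norm_cscale mult.commute)
    qed
  qed simp
  then obtain G where G: "\<And>u. u \<in> ball z0 r \<Longrightarrow> (\<lambda>n. F n u) \<longlonglongrightarrow> G u"
    "\<And>u. u \<in> ball z0 r \<Longrightarrow> (G has_derivative (\<lambda>h. h *\<^sub>M D0 u)) (at u within ball z0 r)" by blast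
  have "has_mat_deriv G (D0 z0) z0"
    using G(2)[of z0] r(1) by (simp add: has_mat_deriv_def at_within_open[of _ "ball z0 r"])
  then show ?thesis unfolding D0_def
  proof (rule has_mat_deriv_transform[of _ _ _ "ball z0 r"])
    fix u assume u: "u \<in> ball z0 r"
    then show "G u = deriv_mat (\<Phi> u) l0 ** adjugate (\<Phi> u l0)"
      using LIMSEQ_unique[OF G(1) limF] in_U by simp
  qed (use r in auto)
qed


section \<open>The Hopf differential of a loop Weierstrass immersion\<close>

text \<open>The quotient rule for \<open>P / tr P\<close> with \<open>P = Y Y\<^sup>*\<close>. The normal is Hermitian, so its derivative is of the
  form \<open>v Z + (v Z)\<^sup>*\<close>, where \<open>Z\<close> collects the terms with the derivative of \<open>Y\<close> but not of \<open>Y\<^sup>*\<close>.\<close>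

lemma normal_of_has_derivative:
  assumes Y: "has_mat_deriv Y Y' z" and nz: "Y z \<noteq> 0"
  defines "P \<equiv> Y z ** cadjoint (Y z)" and "W \<equiv> Y' ** cadjoint (Y z)"
  defines "Z \<equiv> (- 2 / trace P) *\<^sub>M W + (2 * trace W / (trace P)\<^sup>2) *\<^sub>M P"
  shows "((\<lambda>u. normal_of (Y u)) has_derivative (\<lambda>v. v *\<^sub>M Z + cadjoint (v *\<^sub>M Z))) (at z)"
proof -
  have t: "trace P \<noteq> 0" "cnj (trace P) = trace P" and P: "cadjoint P = P"
    using trace_star_nonzero[OF nz] by (simp_all add: P_def trace_cadjoint_mult cadjoint_mult cadjoint_cadjoint)
  have dP: "((\<lambda>u. Y u ** cadjoint (Y u)) has_derivative (\<lambda>v. cadjoint (v *\<^sub>M W) + v *\<^sub>M W)) (at z)"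
    using bounded_bilinear.FDERIV[OF bounded_bilinear_mat_mult Y[unfolded has_mat_deriv_def] has_derivative_cadjoint[OF Y]]
    by (simp add: W_def cadjoint_mult cadjoint_cadjoint)
  have dt: "((\<lambda>u. 2 / trace (Y u ** cadjoint (Y u))) has_derivative
      (\<lambda>v. (0 * trace P - 2 * trace (cadjoint (v *\<^sub>M W) + v *\<^sub>M W)) / (trace P * trace P))) (at z)"
    unfolding P_def
    by (intro has_derivative_divide' has_derivative_const bounded_linear.has_derivative[OF bounded_linear_trace dP])
      (use t in \<open>simp add: P_def\<close>)
  have "((\<lambda>u. mat 1 - (2 / trace (Y u ** cadjoint (Y u))) *\<^sub>M (Y u ** cadjoint (Y u))) has_derivative
      (\<lambda>v. 0 - ((2 / trace P) *\<^sub>M (cadjoint (v *\<^sub>M W) + v *\<^sub>M W) +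
        ((0 * trace P - 2 * trace (cadjoint (v *\<^sub>M W) + v *\<^sub>M W)) / (trace P * trace P)) *\<^sub>M P))) (at z)"
    unfolding P_def
    by (intro has_derivative_diff has_derivative_const
        bounded_bilinear.FDERIV[OF bounded_bilinear_cscale dt[unfolded P_def] dP])
  moreover have "0 - ((2 / trace P) *\<^sub>M (cadjoint (v *\<^sub>M W) + v *\<^sub>M W) +
        ((0 * trace P - 2 * trace (cadjoint (v *\<^sub>M W) + v *\<^sub>M W)) / (trace P * trace P)) *\<^sub>M P)
      = v *\<^sub>M Z + cadjoint (v *\<^sub>M Z)" for v
    by (simp add: Z_def cadjoint_add P trace_add' trace_cadjoint t(2) cscale_add_right power2_eq_square)
      (simp add: cscale_def vec_eq_iff field_simps t(1))
  ultimately show ?thesis by (simp add: normal_of_def)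
qed

text \<open>The matrix multiplied by \<open>Y\<close> is the one in the derivative of the normal. Its summand in \<open>P\<close> drops out
  because \<open>Y Y = 0\<close>, and \<open>Y W = Q P\<close>.\<close>

lemma trace_normal_derivative:
  assumes Y: "trace Y = 0" "det Y = 0" "Y \<noteq> 0" and Q: "Y ** Y' = Q *\<^sub>M Y"
  defines "P \<equiv> Y ** cadjoint Y" and "W \<equiv> Y' ** cadjoint Y"
  shows "trace (Y ** ((- 2 / trace P) *\<^sub>M W + (2 * trace W / (trace P)\<^sup>2) *\<^sub>M P)) = - 2 * Q"
proof -
  have "Y ** P = 0" using square_trace_free Y by (simp add: P_def expand_mat)
  moreover have "Y ** W = Q *\<^sub>M P" by (simp add: P_def W_def expand_mat Q)
  ultimately show ?thesis using trace_star_nonzero[OF Y(3)] by (simp add: expand_mat P_def)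
qed

definition conjugated :: "frame \<Rightarrow> (complex \<Rightarrow> cmat2) \<Rightarrow> complex \<Rightarrow> complex \<Rightarrow> cmat2" where
  "conjugated \<Phi> A l u = \<Phi> u l ** A u ** adjugate (\<Phi> u l)"

context
  fixes U A B \<Phi>
  assumes \<Phi>: "lwr_frame U A B \<Phi>" and U: "open U"
begin

lemma frame_inverse:
  assumes "z \<in> U"
  shows "\<Phi> z l ** adjugate (\<Phi> z l) = mat 1" "adjugate (\<Phi> z l) ** \<Phi> z l = mat 1"
    "X ** \<Phi> z l ** adjugate (\<Phi> z l) = X" "X ** adjugate (\<Phi> z l) ** \<Phi> z l = X"
proof -
  have "det (\<Phi> z l) = 1" using \<Phi> assms by (simp add: lwr_frame_def)
  from unimodular_adjugate[OF this] show "\<Phi> z l ** adjugate (\<Phi> z l) = mat 1" "adjugate (\<Phi> z l) ** \<Phi> z l = mat 1"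
    "X ** \<Phi> z l ** adjugate (\<Phi> z l) = X" "X ** adjugate (\<Phi> z l) ** \<Phi> z l = X"
    by (simp_all flip: matrix_mul_assoc)
qed

lemma potential_nilpotent:
  assumes "z \<in> U" shows "trace (A z) = 0" "det (A z) = 0" "A z ** A z = 0"
proof -
  show 1: "trace (A z) = 0" "det (A z) = 0"
    using \<Phi> assms nilpotent_det by (auto simp: lwr_frame_def lwr_potential_def)
  show "A z ** A z = 0" using square_trace_free[OF 1(1)] 1(2) by simp
qed

lemma conjugated_nilpotent:
  assumes "z \<in> U"
  shows "trace (conjugated \<Phi> A l z) = 0" "det (conjugated \<Phi> A l z) = 0"
    "conjugated \<Phi> A l z = 0 \<longleftrightarrow> A z = 0"
proof -
  have "trace (conjugated \<Phi> A l z) = trace (adjugate (\<Phi> z l) ** (\<Phi> z l ** A z))"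
    unfolding conjugated_def by (rule trace_mul_sym)
  then show "trace (conjugated \<Phi> A l z) = 0"
    using potential_nilpotent[OF assms] by (simp add: matrix_mul_assoc frame_inverse[OF assms])
  show "det (conjugated \<Phi> A l z) = 0"
    by (simp add: conjugated_def det_mul potential_nilpotent[OF assms])
  have "A z = adjugate (\<Phi> z l) ** conjugated \<Phi> A l z ** \<Phi> z l"
    by (simp add: conjugated_def matrix_mul_assoc frame_inverse[OF assms])
  then show "conjugated \<Phi> A l z = 0 \<longleftrightarrow> A z = 0"
    by (metis conjugated_def mult_zero_left_mat mult_zero_right_mat)
qed

lemma conjugated_has_mat_deriv:
  assumes "z \<in> U"
  shows "has_mat_deriv (conjugated \<Phi> A l)
    (\<Phi> z l ** (deriv_mat A z + (l *\<^sub>M A z + B z) ** A z - A z ** (l *\<^sub>M A z + B z)) ** adjugate (\<Phi> z l)) z"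
proof -
  note has_mat_deriv_mult[OF has_mat_deriv_mult[OF lwr_frame_has_mat_deriv[OF \<Phi> U assms, of l]
      lwr_potential_has_mat_deriv(1)[OF \<Phi> U assms]] lwr_frame_inverse_has_mat_deriv[OF \<Phi> U assms, of l]]
  then show ?thesis unfolding conjugated_def[abs_def]
    by (simp add: expand_mat algebra_simps)
qed

text \<open>Conjugation by the frame adds the commutator with \<open>l A + B\<close> to the derivative of \<open>A\<close>.
  Multiplied by \<open>A\<close> from the left this leaves only \<open>A B A\<close>, so the factor \<open>q\<close> does not depend on \<open>l\<close>. This is why the
  Euclidean and the hyperbolic immersion, which use different values of \<open>l\<close>, share their Hopf differential.\<close>

lemma conjugated_hopf_relation:
  assumes z: "z \<in> U" and q: "A z ** deriv_mat A z + A z ** B z ** A z = q *\<^sub>M A z"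
  shows "conjugated \<Phi> A l z **
    (\<Phi> z l ** (deriv_mat A z + (l *\<^sub>M A z + B z) ** A z - A z ** (l *\<^sub>M A z + B z)) ** adjugate (\<Phi> z l))
    = q *\<^sub>M conjugated \<Phi> A l z"
proof -
  have "A z ** (deriv_mat A z + (l *\<^sub>M A z + B z) ** A z - A z ** (l *\<^sub>M A z + B z)) = q *\<^sub>M A z"
    using q by (simp add: expand_mat potential_nilpotent[OF z])
  then have "\<Phi> z l ** (A z ** (deriv_mat A z + (l *\<^sub>M A z + B z) ** A z - A z ** (l *\<^sub>M A z + B z))) ** adjugate (\<Phi> z l)
     = q *\<^sub>M conjugated \<Phi> A l z" by (simp add: conjugated_def)
  then show ?thesis by (simp only: conjugated_def matrix_mul_assoc frame_inverse[OF z])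
qed

lemma regular_set_open: "open {u \<in> U. A u \<noteq> 0}"
proof -
  have "continuous_on U A"
    using lwr_potential_has_mat_deriv(1)[OF \<Phi> U, THEN has_mat_deriv_continuous]
    by (simp add: continuous_at_imp_continuous_on)
  then have "open (U \<inter> A -` (- {0}))" using U by (intro continuous_open_preimage) auto
  moreover have "U \<inter> A -` (- {0}) = {u \<in> U. A u \<noteq> 0}" by auto
  ultimately show ?thesis by simp
qed

text \<open>The Euclidean immersion \<open>\<psi> + \<psi>\<^sup>*\<close> has \<open>d\<psi>/dz = Y\<close> at \<open>l0\<close>. For the hyperbolic immersion \<open>\<Psi>\<^sup>* \<Psi>\<close> one has
  \<open>d\<Psi>/dz = Y \<Psi>\<close> with \<open>Y\<close> at \<open>l1\<close>, so \<open>V = \<Psi>\<^sup>*\<close> transports \<open>Y\<close> to the derivative. Differentiating the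
  transported normal \<open>V n V\<^sup>*\<close> adds the term \<open>n Y\<close> to \<open>Z\<close>, but \<open>Y n Y = - Y Y = 0\<close>, so \<open>tr (Y Z)\<close> is as in the
  Euclidean case.\<close>

lemma has_hopf_differential_induced:
  assumes z: "z \<in> U" "A z \<noteq> 0" and q: "A z ** deriv_mat A z + A z ** B z ** A z = q *\<^sub>M A z"
    and l: "l0 \<noteq> l1"
  shows "has_hopf_differential S (induced S \<Phi> l0 l1) z ((l1 - l0) * q)"
proof -
  define c where "c = l1 - l0"
  have c: "c \<noteq> 0" using l by (simp add: c_def)
  define W where "W = {u \<in> U. A u \<noteq> 0}"
  have W: "open W" "z \<in> W" using regular_set_open z by (simp_all add: W_def)
  have WU: "u \<in> U" if "u \<in> W" for u using that by (simp add: W_def)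
  define Y where "Y l u = c *\<^sub>M conjugated \<Phi> A l u" for l u
  define Y' where "Y' l = c *\<^sub>M (\<Phi> z l ** (deriv_mat A z + (l *\<^sub>M A z + B z) ** A z - A z ** (l *\<^sub>M A z + B z)) ** adjugate (\<Phi> z l))" for l
  have Y: "trace (Y l u) = 0 \<and> det (Y l u) = 0 \<and> Y l u \<noteq> 0" if "u \<in> W" for l u
    using conjugated_nilpotent[of u l] that c by (simp add: Y_def W_def det_cscale cscale_eq_0_iff)
  have dY: "has_mat_deriv (Y l) (Y' l) z" for l
    unfolding Y_def[abs_def] Y'_def by (rule has_mat_deriv_cscale[OF conjugated_has_mat_deriv[OF z(1)]])
  have YY': "Y l z ** Y' l = (c * q) *\<^sub>M Y l z" for l
    unfolding Y_def Y'_def using conjugated_hopf_relation[OF z(1) q, of l] by (simp add: mult_ac)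
  define Z where "Z l = (- 2 / trace (Y l z ** cadjoint (Y l z))) *\<^sub>M (Y' l ** cadjoint (Y l z)) +
    (2 * trace (Y' l ** cadjoint (Y l z)) / (trace (Y l z ** cadjoint (Y l z)))\<^sup>2) *\<^sub>M (Y l z ** cadjoint (Y l z))" for l
  have dn: "((\<lambda>u. normal_of (Y l u)) has_derivative (\<lambda>v. v *\<^sub>M Z l + cadjoint (v *\<^sub>M Z l))) (at z)" for l
    unfolding Z_def using normal_of_has_derivative[OF dY] Y[OF W(2)] by blast
  have YZ: "trace (Y l z ** Z l) = - 2 * (c * q)" for l
    unfolding Z_def by (rule trace_normal_derivative) (use Y[OF W(2)] YY' in auto)
  have "has_hopf_differential S (induced S \<Phi> l0 l1) z (c * q)"
  proof (cases S)
    case Euclidean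
    define \<psi> where "\<psi> u = c *\<^sub>M (deriv_mat (\<Phi> u) l0 ** adjugate (\<Phi> u l0))" for u
    have f: "induced Euclidean \<Phi> l0 l1 u = \<psi> u + cadjoint (\<psi> u)" if "u \<in> W" for u
    proof -
      have "det (\<Phi> u l0) = 1" using \<Phi> WU[OF that] by (simp add: lwr_frame_def)
      then show ?thesis by (simp add: \<psi>_def mat_mult_eq_cscale c_def Let_def matrix_inv_eq_adjugate)
    qed
    have d\<psi>: "has_mat_deriv \<psi> (Y l0 u) u" if "u \<in> W" for u
      unfolding \<psi>_def[abs_def] Y_def conjugated_def
      by (rule has_mat_deriv_cscale[OF spectral_derivative_has_mat_deriv[OF \<Phi> U WU[OF that]]])
    have "trace (\<psi> u) = 0" if "u \<in> W" for u
    proof -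
      have "has_mat_deriv (\<Phi> u) (deriv_mat (\<Phi> u) l0) l0"
        using \<Phi> WU[OF that] by (intro holomorphic_has_mat_deriv[of _ UNIV]) (auto simp: lwr_frame_def)
      then have "trace (deriv_mat (\<Phi> u) l0 ** adjugate (\<Phi> u l0)) = 0"
        by (rule trace_deriv_unimodular[of _ _ _ UNIV]) (use \<Phi> WU[OF that] in \<open>auto simp: lwr_frame_def\<close>)
      then show ?thesis by (simp add: \<psi>_def)
    qed
    then have mem: "induced Euclidean \<Phi> l0 l1 u \<in> model_space Euclidean" if "u \<in> W" for u
      unfolding f[OF that] using that
      by (simp add: hermitian_def cadjoint_add cadjoint_cadjoint trace_add' trace_cadjoint add.commute)
    have df: "(induced Euclidean \<Phi> l0 l1 has_derivative (\<lambda>v. v *\<^sub>M Y l0 u + cadjoint (v *\<^sub>M Y l0 u))) (at u)"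
      if "u \<in> W" for u
    proof (rule has_derivative_transform_within_open[OF _ W(1) that f[symmetric]])
      show "((\<lambda>u. \<psi> u + cadjoint (\<psi> u)) has_derivative (\<lambda>v. v *\<^sub>M Y l0 u + cadjoint (v *\<^sub>M Y l0 u))) (at u)"
        using d\<psi>[OF that] by (intro has_derivative_add has_derivative_cadjoint) (simp_all add: has_mat_deriv_def)
    qed
    show ?thesis unfolding Euclidean
      by (rule has_hopf_differential_adapted[OF W mem, where V = "\<lambda>_. mat 1" and Y = "Y l0" and Z = "Z l0"])
        (use df dn Y YZ in \<open>auto simp: adapted_def cadjoint_mat1 simp del: induced.simps\<close>)
  next
    case Hyperbolic
    define \<Psi> where "\<Psi> u = \<Phi> u l1 ** adjugate (\<Phi> u l0)" for u
    have f: "induced Hyperbolic \<Phi> l0 l1 u = cadjoint (\<Psi> u) ** \<Psi> u" if "u \<in> W" for u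
    proof -
      have "det (\<Phi> u l0) = 1" using \<Phi> WU[OF that] by (simp add: lwr_frame_def)
      then show ?thesis by (simp add: \<Psi>_def Let_def matrix_inv_eq_adjugate)
    qed
    have d\<Psi>: "has_mat_deriv \<Psi> (Y l1 u ** \<Psi> u) u" if "u \<in> W" for u
    proof -
      have "\<Phi> u l1 ** (- ((l0 *\<^sub>M A u + B u) ** adjugate (\<Phi> u l0))) + \<Phi> u l1 ** (l1 *\<^sub>M A u + B u) ** adjugate (\<Phi> u l0)
        = c *\<^sub>M (\<Phi> u l1 ** A u ** adjugate (\<Phi> u l0))"
        by (simp add: expand_mat c_def cscale_diff_left)
      also have "\<dots> = Y l1 u ** \<Psi> u"
        by (simp add: Y_def \<Psi>_def conjugated_def expand_mat frame_inverse[OF WU[OF that]])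
      finally show ?thesis unfolding \<Psi>_def[abs_def]
        using has_mat_deriv_mult[OF lwr_frame_has_mat_deriv[OF \<Phi> U WU[OF that], of l1]
            lwr_frame_inverse_has_mat_deriv[OF \<Phi> U WU[OF that], of l0]] by simp
    qed
    have det\<Psi>: "det (\<Psi> u) = 1" if "u \<in> W" for u
      using \<Phi> WU[OF that] arg_cong[OF frame_inverse(1)[OF WU[OF that], of l0], of det]
      by (simp add: \<Psi>_def det_mul lwr_frame_def)
    have mem: "induced Hyperbolic \<Phi> l0 l1 u \<in> model_space Hyperbolic" if "u \<in> W" for u
    proof -
      have "\<Psi> u \<noteq> 0" using det\<Psi>[OF that] by (auto simp: det_2)
      then have "cadjoint (\<Psi> u) \<noteq> 0" by (simp add: cadjoint_eq_0_iff)
      then show ?thesis unfolding f[OF that]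
        using trace_cadjoint_mult[of "cadjoint (\<Psi> u)"] det\<Psi>[OF that]
        by (simp add: hermitian_def cadjoint_mult cadjoint_cadjoint det_mul det_cadjoint del: of_real_power)
    qed
    have df: "(induced Hyperbolic \<Phi> l0 l1 has_derivative
        (\<lambda>v. cadjoint (\<Psi> u) ** (v *\<^sub>M Y l1 u + cadjoint (v *\<^sub>M Y l1 u)) ** cadjoint (cadjoint (\<Psi> u)))) (at u)"
      if "u \<in> W" for u
    proof (rule has_derivative_transform_within_open[OF _ W(1) that f[symmetric]])
      show "((\<lambda>u. cadjoint (\<Psi> u) ** \<Psi> u) has_derivative
          (\<lambda>v. cadjoint (\<Psi> u) ** (v *\<^sub>M Y l1 u + cadjoint (v *\<^sub>M Y l1 u)) ** cadjoint (cadjoint (\<Psi> u)))) (at u)"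
        using bounded_bilinear.FDERIV[OF bounded_bilinear_mat_mult has_derivative_cadjoint[OF d\<Psi>[OF that]]
            d\<Psi>[OF that, unfolded has_mat_deriv_def]]
        by (simp add: cadjoint_mult cadjoint_cadjoint expand_mat)
    qed
    have "((\<lambda>u. cadjoint (\<Psi> u) ** normal_of (Y l1 u) ** \<Psi> u) has_derivative
        (\<lambda>v. cadjoint (\<Psi> z) ** normal_of (Y l1 z) ** (v *\<^sub>M (Y l1 z ** \<Psi> z)) +
          (cadjoint (\<Psi> z) ** (v *\<^sub>M Z l1 + cadjoint (v *\<^sub>M Z l1)) +
           cadjoint (v *\<^sub>M (Y l1 z ** \<Psi> z)) ** normal_of (Y l1 z)) ** \<Psi> z)) (at z)"
      by (intro bounded_bilinear.FDERIV[OF bounded_bilinear_mat_mult] has_derivative_cadjoint d\<Psi> W dn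
          d\<Psi>[OF W(2), unfolded has_mat_deriv_def])
    moreover have "cadjoint (normal_of (Y l1 z)) = normal_of (Y l1 z)"
      using hermitian_normal_of by (simp add: hermitian_def)
    ultimately have dN: "((\<lambda>u. cadjoint (\<Psi> u) ** normal_of (Y l1 u) ** cadjoint (cadjoint (\<Psi> u))) has_derivative
        (\<lambda>v. cadjoint (\<Psi> z) ** (v *\<^sub>M (Z l1 + normal_of (Y l1 z) ** Y l1 z) +
          cadjoint (v *\<^sub>M (Z l1 + normal_of (Y l1 z) ** Y l1 z))) ** cadjoint (cadjoint (\<Psi> z)))) (at z)"
      by (simp add: cadjoint_mult cadjoint_cadjoint cadjoint_add expand_mat algebra_simps)
    have "Y l1 z ** (normal_of (Y l1 z) ** Y l1 z) = 0"
      using normal_of_mult(1)[of "Y l1 z"] square_trace_free[of "Y l1 z"] Y[OF W(2), of l1] by (simp add: expand_mat)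
    then have "trace (Y l1 z ** (Z l1 + normal_of (Y l1 z) ** Y l1 z)) = - 2 * (c * q)"
      using YZ[of l1] by (simp add: matrix_add_ldistrib)
    from has_hopf_differential_adapted[OF W mem _ df Y dN this]
    show ?thesis unfolding Hyperbolic
      using det\<Psi> by (simp add: adapted_def f cadjoint_cadjoint det_cadjoint del: induced.simps)
  qed
  then show ?thesis by (simp add: c_def)
qed

end

section \<open>Simple factor dressing\<close>

text \<open>A simple factor acts as \<open>l - \<alpha>\<close> on one line and as \<open>1\<close> on the other. The matrix \<open>\<pi>\<close> is the projection to the
  first line along the second.\<close>

lemma simple_factor_projection:
  assumes "simple_factor g"
  obtains \<alpha> \<pi> where "\<And>l. g l = mat 1 + (l - \<alpha> - 1) *\<^sub>M \<pi>" "trace \<pi> = 1" "det \<pi> = 0"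
proof -
  obtain \<alpha> and S :: cmat2 where S: "invertible S"
    and g: "\<And>l. g l = S ** vector [vector [l - \<alpha>, 0], vector [0, 1]] ** matrix_inv S"
    using assms unfolding simple_factor_def is_SF_def by blast
  have inv: "S ** matrix_inv S = mat 1" "matrix_inv S ** S = mat 1"
    using S unfolding matrix_inv_def invertible_def by (metis (mono_tags, lifting) someI_ex)+
  define E :: cmat2 where "E = vector [vector [1, 0], vector [0, 0]]"
  define \<pi> where "\<pi> = S ** E ** matrix_inv S"
  have "vector [vector [l - \<alpha>, 0], vector [0, 1]] = mat 1 + (l - \<alpha> - 1) *\<^sub>M E" for l
    by (simp add: E_def entrywise)
  then have "g l = mat 1 + (l - \<alpha> - 1) *\<^sub>M \<pi>" for l
    by (simp add: g \<pi>_def expand_mat inv)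
  moreover have "trace \<pi> = trace (matrix_inv S ** (S ** E))" unfolding \<pi>_def by (rule trace_mul_sym)
  then have "trace \<pi> = 1" by (simp add: matrix_mul_assoc inv) (simp add: E_def entrywise)
  moreover have "det \<pi> = 0" by (simp add: \<pi>_def det_mul) (simp add: E_def det_2 vector_2)
  ultimately show thesis using that by blast
qed

lemma det_rank_one_update:
  fixes \<pi> :: cmat2
  assumes "trace \<pi> = 1" "det \<pi> = 0" shows "det (mat 1 + c *\<^sub>M \<pi>) = 1 + c"
proof -
  have "det (mat 1 + c *\<^sub>M \<pi>) = 1 + c * trace \<pi> + c\<^sup>2 * det \<pi>"
    by (simp add: det_2 trace_def sum_2 mat_def cscale_def power2_eq_square algebra_simps)
  then show ?thesis by (simp add: assms)
qed

lemma idempotent_of_trace_det: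
  fixes \<pi> :: cmat2
  assumes "trace \<pi> = 1" "det \<pi> = 0" shows "\<pi> ** \<pi> = \<pi>"
  using rank_one_sandwich[OF assms(2), of "mat 1"] assms(1) by simp

text \<open>Since \<open>\<pi>\<close> is idempotent, \<open>\<pi> A = A' \<pi> = A' \<pi> \<pi> = \<pi> A \<pi>\<close>, which is \<open>tr (\<pi> A) \<pi>\<close> as \<open>\<pi>\<close> has rank one.
  Multiplying by \<open>A\<close> from the right gives \<open>tr (\<pi> A) \<pi> A = 0\<close>, so \<open>\<pi> A = 0\<close> in either case. The
  identities with the factors interchanged are the adjugates of those found so far. Geometrically, for
  nonzero \<open>A\<close> and \<open>A'\<close>: the second line of the simple factor is spanned by the spinor of \<open>A\<close>, the first one by that of \<open>A'\<close>.\<close>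

lemma intertwined_nilpotents:
  fixes A A' \<pi> :: cmat2
  assumes \<pi>: "trace \<pi> = 1" "det \<pi> = 0"
    and A: "trace A = 0" "det A = 0" and A': "trace A' = 0" "det A' = 0"
    and eq: "A' ** \<pi> = \<pi> ** A"
  shows "\<pi> ** A = 0" "A ** \<pi> = A" "A' ** \<pi> = 0" "\<pi> ** A' = A'"
proof -
  have AA: "A ** A = 0" using square_trace_free A by simp
  have "\<pi> ** A ** \<pi> = A' ** (\<pi> ** \<pi>)" by (simp add: eq matrix_mul_assoc)
  then have "\<pi> ** A = \<pi> ** A ** \<pi>" by (simp add: idempotent_of_trace_det[OF \<pi>] eq)
  also have "\<dots> = trace (\<pi> ** A) *\<^sub>M \<pi>" by (rule rank_one_sandwich[OF \<pi>(2)])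
  finally have 1: "\<pi> ** A = trace (\<pi> ** A) *\<^sub>M \<pi>" .
  have "trace (\<pi> ** A) *\<^sub>M (\<pi> ** A) = (trace (\<pi> ** A) *\<^sub>M \<pi>) ** A" by simp
  also have "\<dots> = \<pi> ** A ** A" by (simp only: 1[symmetric])
  also have "\<dots> = 0" using AA by (simp flip: matrix_mul_assoc add: mult_zero_right_mat)
  finally show 2: "\<pi> ** A = 0" using 1 by (auto simp: cscale_eq_0_iff)
  then show 3: "A' ** \<pi> = 0" by (simp add: eq)
  have z: "adjugate 0 = 0" by (simp add: entrywise)
  have "adjugate \<pi> = mat 1 - \<pi>" "adjugate A = - A" "adjugate A' = - A'"
    using \<pi> A A' by (simp_all add: adjugate_trace)
  then show "A ** \<pi> = A" "\<pi> ** A' = A'"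
    using arg_cong[OF 2, of adjugate] arg_cong[OF 3, of adjugate]
    by (simp_all add: adjugate_mult z expand_mat)
qed

text \<open>From \<open>A p = 0\<close> and \<open>A = p A\<close> one gets \<open>A (dA/dz) = A (dp/dz) A\<close>: the derivative of \<open>A\<close> can be traded
  for that of \<open>p\<close>. The lemma serves both frames, with \<open>p = 1 - \<pi>\<close> and \<open>p = \<pi>\<close>, and \<open>N\<close> is the
  nilpotent coefficient of the other frame.\<close>

lemma hopf_relation_of_projection:
  fixes A dA B p dp N :: cmat2
  assumes "p ** A = A" "A ** p = 0" "dp ** A + p ** dA = dA"
    and "dp = p ** (B + c *\<^sub>M A) - (B + c *\<^sub>M A) ** p + N - A"
    and "A ** A = 0"
  shows "A ** dA + A ** B ** A = A ** N ** A"
proof -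
  have "A ** dA = A ** (dp ** A + p ** dA)" by (simp only: assms(3))
  also have "\<dots> = A ** dp ** A" by (simp add: expand_mat assms(2))
  also have "\<dots> = A ** N ** A - A ** B ** A"
  proof -
    have "A ** X ** p ** A = A ** X ** A" "X ** A ** A = 0" for X
      using assms(1,5) by (simp_all flip: matrix_mul_assoc add: mult_zero_right_mat)
    then show ?thesis by (simp add: assms(4) expand_mat assms(2,5))
  qed
  finally show ?thesis by simp
qed

text \<open>The determinants of \<open>g\<close> and of the simple factor at \<open>z\<close> are \<open>l - \<alpha>\<close> and \<open>l - \<beta>\<close>. They agree
  because the frames have determinant \<open>1\<close>, so the singular point \<open>\<beta>\<close> does not vary with \<open>z\<close>.\<close>

lemma dressing_projection:
  assumes \<Phi>: "lwr_frame U A B \<Phi>" and \<Phi>': "lwr_frame (U - P) A' B' \<Phi>'"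
    and g: "\<And>l. g l = mat 1 + (l - \<alpha> - 1) *\<^sub>M \<gamma>" "trace \<gamma> = 1" "det \<gamma> = 0"
    and dressing: "is_dressing U g \<Phi> P \<Phi>'" and z: "z \<in> U - P"
  shows "\<exists>\<pi>. trace \<pi> = 1 \<and> det \<pi> = 0 \<and>
    (\<forall>l. l \<noteq> \<alpha> \<longrightarrow> \<Phi>' z l ** (mat 1 + (l - \<alpha> - 1) *\<^sub>M \<pi>) = g l ** \<Phi> z l)"
proof -
  obtain h where "simple_factor (h z)"
    and eq: "\<And>l. invertible (h z l) \<Longrightarrow> \<Phi>' z l = g l ** \<Phi> z l ** matrix_inv (h z l)"
    using dressing z by (auto simp: is_dressing_def)
  then obtain \<beta> \<pi> where h: "\<And>l. h z l = mat 1 + (l - \<beta> - 1) *\<^sub>M \<pi>" and \<pi>: "trace \<pi> = 1" "det \<pi> = 0"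
    using simple_factor_projection by metis
  have inter: "\<Phi>' z l ** h z l = g l ** \<Phi> z l" if "l \<noteq> \<beta>" for l
  proof -
    have "det (h z l) \<noteq> 0" using that unfolding h det_rank_one_update[OF \<pi>] by simp
    then have inv: "invertible (h z l)" by (simp add: invertible_det_nz)
    have "matrix_inv (h z l) ** h z l = mat 1"
      using inv unfolding matrix_inv_def invertible_def by (metis (mono_tags, lifting) someI_ex)
    then show ?thesis by (simp add: eq[OF inv] flip: matrix_mul_assoc)
  qed
  have "det (\<Phi>' z (\<beta> + 1)) = 1" "det (\<Phi> z (\<beta> + 1)) = 1"
    using \<Phi> \<Phi>' z by (auto simp: lwr_frame_def)
  then have "det (h z (\<beta> + 1)) = det (g (\<beta> + 1))"
    using arg_cong[OF inter[of "\<beta> + 1"], of det] by (simp add: det_mul)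
  then have "\<beta> = \<alpha>" unfolding h g(1) det_rank_one_update[OF \<pi>] det_rank_one_update[OF g(2,3)] by simp
  then show ?thesis using inter \<pi> h by auto
qed

text \<open>The infinitesimal form of \<open>\<Phi>' h = G \<Phi>\<close> with constant \<open>G\<close>: \<open>h\<close> is a gauge transformation between the two
  potentials.\<close>

lemma intertwining_relation:
  assumes \<Phi>: "lwr_frame V A B \<Phi>" and \<Phi>': "lwr_frame V A' B' \<Phi>'" and V: "open V" "z \<in> V"
    and h: "\<And>u. u \<in> V \<Longrightarrow> \<Phi>' u l ** h u = G ** \<Phi> u l" and dh: "has_mat_deriv h D z"
  shows "D + (l *\<^sub>M A' z + B' z) ** h z = h z ** (l *\<^sub>M A z + B z)"
proof -
  have "has_mat_deriv (\<lambda>u. \<Phi>' u l ** h u)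
      (\<Phi>' z l ** D + \<Phi>' z l ** (l *\<^sub>M A' z + B' z) ** h z) z"
    by (rule has_mat_deriv_mult[OF lwr_frame_has_mat_deriv[OF \<Phi>' V] dh])
  then have "has_mat_deriv (\<lambda>u. G ** \<Phi> u l)
      (\<Phi>' z l ** D + \<Phi>' z l ** (l *\<^sub>M A' z + B' z) ** h z) z"
    by (rule has_mat_deriv_transform[OF _ V h])
  moreover have "has_mat_deriv (\<lambda>u. G ** \<Phi> u l) (G ** (\<Phi> z l ** (l *\<^sub>M A z + B z)) + 0 ** \<Phi> z l) z"
    by (rule has_mat_deriv_mult[OF has_mat_deriv_const lwr_frame_has_mat_deriv[OF \<Phi> V]])
  ultimately have "\<Phi>' z l ** D + \<Phi>' z l ** (l *\<^sub>M A' z + B' z) ** h z =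
      G ** (\<Phi> z l ** (l *\<^sub>M A z + B z)) + 0 ** \<Phi> z l" by (rule has_mat_deriv_unique)
  also have "\<dots> = \<Phi>' z l ** h z ** (l *\<^sub>M A z + B z)"
    by (simp only: h[OF V(2)] matrix_mul_assoc mult_zero_left_mat add_0_right)
  finally have "\<Phi>' z l ** (D + (l *\<^sub>M A' z + B' z) ** h z) = \<Phi>' z l ** (h z ** (l *\<^sub>M A z + B z))"
    by (simp only: matrix_add_ldistrib matrix_mul_assoc)
  then have "adjugate (\<Phi>' z l) ** (\<Phi>' z l ** (D + (l *\<^sub>M A' z + B' z) ** h z)) =
      adjugate (\<Phi>' z l) ** (\<Phi>' z l ** (h z ** (l *\<^sub>M A z + B z)))" by (rule arg_cong)
  then show ?thesis
    by (simp only: matrix_mul_assoc frame_inverse[OF \<Phi>' V] matrix_mul_lid)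
qed

text \<open>With \<open>l = c + n\<close> and \<open>c = \<alpha> + 1\<close> the simple factor is \<open>1 + n \<pi>\<close>, and the gauge relation becomes a
  polynomial identity in \<open>n\<close> for \<open>n \<noteq> -1\<close>. The values \<open>0\<close>, \<open>1\<close> and \<open>2\<close> of \<open>n\<close> separate its
  coefficients. The relations \<open>\<pi> A = 0\<close> and \<open>\<pi> A' = A'\<close> hold on the whole domain of the dressed frame and may
  therefore be differentiated.\<close>

lemma dressing_hopf_relation:
  assumes \<Phi>: "lwr_frame U A B \<Phi>" and \<Phi>': "lwr_frame (U - P) A' B' \<Phi>'"
    and U: "open U" and g: "simple_factor g" and dressing: "is_dressing U g \<Phi> P \<Phi>'"
    and z: "z \<in> U - P"
  defines "q \<equiv> trace (A z ** A' z)"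
  shows "A z ** deriv_mat A z + A z ** B z ** A z = q *\<^sub>M A z"
    and "A' z ** deriv_mat A' z + A' z ** B' z ** A' z = q *\<^sub>M A' z"
proof -
  define V where "V = U - P"
  have V: "open V" using U dressing by (auto simp: V_def is_dressing_def intro: open_diff_sparse_pts)
  have zV: "z \<in> V" using z by (simp add: V_def)
  note \<Phi>' = \<Phi>'[folded V_def]
  have \<Phi>V: "lwr_frame V A B \<Phi>"
    using \<Phi> by (auto simp: V_def lwr_frame_def lwr_potential_def holomorphic_mat_on_def
        intro: holomorphic_on_subset[of _ U])
  obtain \<alpha> \<gamma> where \<gamma>: "\<And>l. g l = mat 1 + (l - \<alpha> - 1) *\<^sub>M \<gamma>" "trace \<gamma> = 1" "det \<gamma> = 0"
    using simple_factor_projection[OF g] by blast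
  have "\<forall>u\<in>V. \<exists>\<pi>. trace \<pi> = 1 \<and> det \<pi> = 0 \<and>
      (\<forall>l. l \<noteq> \<alpha> \<longrightarrow> \<Phi>' u l ** (mat 1 + (l - \<alpha> - 1) *\<^sub>M \<pi>) = g l ** \<Phi> u l)"
    using dressing_projection[OF \<Phi> \<Phi>'[unfolded V_def] \<gamma> dressing] by (simp add: V_def)
  then obtain \<pi> where \<pi>: "\<And>u. u \<in> V \<Longrightarrow> trace (\<pi> u) = 1" "\<And>u. u \<in> V \<Longrightarrow> det (\<pi> u) = 0"
    and inter: "\<And>u l. u \<in> V \<Longrightarrow> l \<noteq> \<alpha> \<Longrightarrow> \<Phi>' u l ** (mat 1 + (l - \<alpha> - 1) *\<^sub>M \<pi> u) = g l ** \<Phi> u l"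
    by metis
  define c where "c = \<alpha> + 1"
  have inter': "\<Phi>' u (c + n) ** (mat 1 + n *\<^sub>M \<pi> u) = g (c + n) ** \<Phi> u (c + n)" if "u \<in> V" "n \<noteq> -1" for u n
  proof -
    have "c + n \<noteq> \<alpha>"
    proof
      assume "c + n = \<alpha>"
      then have "n = \<alpha> - c" by (metis add_diff_cancel_left')
      then have "n = -1" by (simp add: c_def)
      then show False using that(2) by contradiction
    qed
    from inter[OF that(1) this] show ?thesis by (simp add: c_def)
  qed
  \<comment> \<open>\<open>\<pi>\<close> is chosen pointwise; solving for it at \<open>n = 1\<close> shows that it is holomorphic.\<close>
  have \<pi>_eq: "adjugate (\<Phi>' u (c + 1)) ** (g (c + 1) ** \<Phi> u (c + 1)) - mat 1 = \<pi> u" if "u \<in> V" for u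
    using inter'[OF that, of 1, symmetric] by (simp add: matrix_mul_assoc frame_inverse[OF \<Phi>' V that])
  have d\<pi>: "\<exists>D. has_mat_deriv \<pi> D u" if u: "u \<in> V" for u
  proof -
    have "\<exists>D. has_mat_deriv (\<lambda>u. adjugate (\<Phi>' u (c + 1)) ** (g (c + 1) ** \<Phi> u (c + 1)) - mat 1) D u"
      by (intro exI, rule has_mat_deriv_diff[OF has_mat_deriv_mult[OF lwr_frame_inverse_has_mat_deriv[OF \<Phi>' V u]
            has_mat_deriv_mult[OF has_mat_deriv_const lwr_frame_has_mat_deriv[OF \<Phi>V V u]]] has_mat_deriv_const])
    then obtain D where "has_mat_deriv (\<lambda>u. adjugate (\<Phi>' u (c + 1)) ** (g (c + 1) ** \<Phi> u (c + 1)) - mat 1) D u" ..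
    then have "has_mat_deriv \<pi> D u" by (rule has_mat_deriv_transform[OF _ V u \<pi>_eq])
    then show ?thesis ..
  qed
  have rel: "n *\<^sub>M D + ((c + n) *\<^sub>M A' u + B' u) ** (mat 1 + n *\<^sub>M \<pi> u)
      = (mat 1 + n *\<^sub>M \<pi> u) ** ((c + n) *\<^sub>M A u + B u)"
    if u: "u \<in> V" and D: "has_mat_deriv \<pi> D u" and n: "n \<noteq> -1" for u D n
  proof -
    have "has_mat_deriv (\<lambda>u. mat 1 - (- n) *\<^sub>M \<pi> u) (0 - (- n) *\<^sub>M D) u"
      by (rule has_mat_deriv_diff[OF has_mat_deriv_const has_mat_deriv_cscale[OF D]])
    then have "has_mat_deriv (\<lambda>u. mat 1 + n *\<^sub>M \<pi> u) (n *\<^sub>M D) u" by (simp add: cscale_minus_left)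
    from intertwining_relation[OF \<Phi>V \<Phi>' V u inter'[OF _ n] this] show ?thesis by simp
  qed
  \<comment> \<open>At \<open>n = 0\<close> both simple factors are the identity.\<close>
  have T: "c *\<^sub>M A' u + B' u = c *\<^sub>M A u + B u" if u: "u \<in> V" for u
    using d\<pi>[OF u] rel[OF u, of _ 0] by auto
  have step: "D + A' u + n *\<^sub>M (A' u ** \<pi> u) + (c *\<^sub>M A u + B u) ** \<pi> u
      = A u + n *\<^sub>M (\<pi> u ** A u) + \<pi> u ** (c *\<^sub>M A u + B u)"
    if u: "u \<in> V" and D: "has_mat_deriv \<pi> D u" and n: "n \<noteq> -1" "n \<noteq> 0" for u D n
  proof -
    have shift: "(c + n) *\<^sub>M X + Y = (c *\<^sub>M X + Y) + n *\<^sub>M X" for X Y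
      by (simp add: cscale_add_left algebra_simps)
    have "n *\<^sub>M D + ((c *\<^sub>M A u + B u) + n *\<^sub>M A' u) ** (mat 1 + n *\<^sub>M \<pi> u)
      = (mat 1 + n *\<^sub>M \<pi> u) ** ((c *\<^sub>M A u + B u) + n *\<^sub>M A u)"
      using rel[OF u D n(1)] unfolding shift T[OF u] .
    then have "n *\<^sub>M (D + A' u + n *\<^sub>M (A' u ** \<pi> u) + (c *\<^sub>M A u + B u) ** \<pi> u)
      = n *\<^sub>M (A u + n *\<^sub>M (\<pi> u ** A u) + \<pi> u ** (c *\<^sub>M A u + B u))"
      by (simp add: expand_mat algebra_simps)
    then show ?thesis using n(2) by (simp add: cscale_cancel)
  qed
  have intertwined: "A' u ** \<pi> u = \<pi> u ** A u" if u: "u \<in> V" for u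
  proof -
    obtain D where D: "has_mat_deriv \<pi> D u" using d\<pi>[OF u] by blast
    have diff: "(X + 2 *\<^sub>M Y + Z) - (X + 1 *\<^sub>M Y + Z) = Y" for X Y Z
      by (simp add: entrywise)
    show ?thesis
      using arg_cong2[of _ _ _ _ minus, OF step[OF u D, of 2] step[OF u D, of 1]] unfolding diff by simp
  qed
  have tame: "\<pi> u ** A u = 0" "A u ** \<pi> u = A u" "A' u ** \<pi> u = 0" "\<pi> u ** A' u = A' u"
    if u: "u \<in> V" for u
    using intertwined_nilpotents[OF \<pi>[OF u] potential_nilpotent(1,2)[OF \<Phi>V V u]
        potential_nilpotent(1,2)[OF \<Phi>' V u] intertwined[OF u]] by blast+
  obtain D where D: "has_mat_deriv \<pi> D z" using d\<pi>[OF zV] by blast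
  have D_eq: "D = \<pi> z ** (B z + c *\<^sub>M A z) - (B z + c *\<^sub>M A z) ** \<pi> z + A z - A' z"
    using step[OF zV D, of 1] tame[OF zV]
    by (simp add: algebra_simps)
  note dA = lwr_potential_has_mat_deriv(1)[OF \<Phi>V V zV] and dA' = lwr_potential_has_mat_deriv(1)[OF \<Phi>' V zV]
  have "A z ** deriv_mat A z + A z ** B z ** A z = A z ** A' z ** A z"
  proof (rule hopf_relation_of_projection[where p = "mat 1 - \<pi> z" and dp = "0 - D" and c = c])
    show "(0 - D) ** A z + (mat 1 - \<pi> z) ** deriv_mat A z = deriv_mat A z"
    proof (rule has_mat_deriv_unique)
      show "has_mat_deriv A (deriv_mat A z) z" by (rule dA)
      have "has_mat_deriv (\<lambda>u. (mat 1 - \<pi> u) ** A u) ((mat 1 - \<pi> z) ** deriv_mat A z + (0 - D) ** A z) z"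
        by (rule has_mat_deriv_mult[OF has_mat_deriv_diff[OF has_mat_deriv_const D] dA])
      then have "has_mat_deriv A ((mat 1 - \<pi> z) ** deriv_mat A z + (0 - D) ** A z) z"
        by (rule has_mat_deriv_transform[OF _ V zV]) (simp add: mult_diff_left tame)
      then show "has_mat_deriv A ((0 - D) ** A z + (mat 1 - \<pi> z) ** deriv_mat A z) z"
        by (simp only: add.commute)
    qed
    show "0 - D = (mat 1 - \<pi> z) ** (B z + c *\<^sub>M A z) - (B z + c *\<^sub>M A z) ** (mat 1 - \<pi> z) + A' z - A z"
      by (simp add: D_eq mult_diff_left mult_diff_right algebra_simps)
  qed (use tame[OF zV] potential_nilpotent(3)[OF \<Phi>V V zV] in \<open>auto simp: expand_mat\<close>)
  also have "\<dots> = q *\<^sub>M A z"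
    unfolding q_def by (rule rank_one_sandwich[OF potential_nilpotent(2)[OF \<Phi>V V zV]])
  finally show "A z ** deriv_mat A z + A z ** B z ** A z = q *\<^sub>M A z" .
  have "A' z ** deriv_mat A' z + A' z ** B' z ** A' z = A' z ** A z ** A' z"
  proof (rule hopf_relation_of_projection[where p = "\<pi> z" and dp = D and c = c])
    show "D ** A' z + \<pi> z ** deriv_mat A' z = deriv_mat A' z"
    proof (rule has_mat_deriv_unique)
      show "has_mat_deriv A' (deriv_mat A' z) z" by (rule dA')
      show "has_mat_deriv A' (D ** A' z + \<pi> z ** deriv_mat A' z) z"
        using has_mat_deriv_transform[OF has_mat_deriv_mult[OF D dA'] V zV, of A'] tame
        by (simp add: add.commute)
    qed
    show "D = \<pi> z ** (B' z + c *\<^sub>M A' z) - (B' z + c *\<^sub>M A' z) ** \<pi> z + A z - A' z"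
      using D_eq T[OF zV] by (simp add: add.commute)
  qed (use tame[OF zV] potential_nilpotent(3)[OF \<Phi>' V zV] in auto)
  also have "\<dots> = q *\<^sub>M A' z"
    unfolding q_def trace_mul_sym[of "A z"] by (rule rank_one_sandwich[OF potential_nilpotent(2)[OF \<Phi>' V zV]])
  finally show "A' z ** deriv_mat A' z + A' z ** B' z ** A' z = q *\<^sub>M A' z" .
qed

theorem corollary8p5:
  fixes U P :: "complex set" and \<Phi> \<Phi>' :: frame and A B A' B' :: "complex \<Rightarrow> cmat2"
    and g :: "complex \<Rightarrow> cmat2" and l0 l1 z :: complex
  assumes "open U" and "connected U"
    and "lwr_frame U A B \<Phi>" and "non_flat U \<Phi>"
    and "simple_factor g"
    and "is_dressing U g \<Phi> P \<Phi>'" and "lwr_frame (U - P) A' B' \<Phi>'"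
    and "l0 \<noteq> l1"
    and "z \<in> U - P" and "A z \<noteq> 0" and "A' z \<noteq> 0"
  shows "\<exists>Q. \<forall>S. has_hopf_differential S (induced S \<Phi> l0 l1) z Q \<and>
                 has_hopf_differential S (induced S \<Phi>' l0 l1) z Q"
proof -
  have open_diff: "open (U - P)"
    using \<open>open U\<close> \<open>is_dressing U g \<Phi> P \<Phi>'\<close> by (auto simp: is_dressing_def intro: open_diff_sparse_pts)
  note q = dressing_hopf_relation[OF assms(3,7,1,5,6,9)]
  have "has_hopf_differential S (induced S \<Phi> l0 l1) z ((l1 - l0) * trace (A z ** A' z))" for S
    using has_hopf_differential_induced[OF assms(3,1) _ assms(10) q(1) assms(8)] assms(9) by blast
  moreover have "has_hopf_differential S (induced S \<Phi>' l0 l1) z ((l1 - l0) * trace (A z ** A' z))" for S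
    by (rule has_hopf_differential_induced[OF assms(7) open_diff assms(9,11) q(2) assms(8)])
  ultimately show ?thesis by blast
qed

end
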